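(* Let $\beta$ be a quadratic Pisot unit, and let $\mathcal{A}$ be a finite set of consecutive integers with $0\in\mathcal{A}$ and $\#\mathcal{A}>\beta$. Suppose that either $\alpha=-\beta$, or $\alpha=\beta$ and $\{-1,0,1\}\subset\mathcal{A}$. Then there exist real numbers $\Delta_1,\Delta_2>0$ such that the distances between consecutive points in $X^{\mathcal{A}}(\alpha)$ take values in $\{\Delta_1,\Delta_2,\Delta_1+\Delta_2\}$. Moreover, the bidirectional sequence of gaps in $X^{\mathcal{A}}(\alpha)$ is a coding of an exchange of three intervals.
   Context: A quadratic Pisot unit is a real number $\beta>1$ which is the larger root of $x^2-px-1$ with an integer $p\geq 1$, or of $x^2-px+1$ with an integer $p\geq 3$. For a real $\alpha$ with $|\alpha|>1$ and a finite set $\mathcal{A}\ni 0$ of consecutive integers, $$X^{\mathcal{A}}(\alpha) = \Big\{\sum_{j=0}^n a_j \alpha^j : n\in\mathbb{N},\ a_j\in\mathcal{A}\Big\},$$ where $\mathbb{N}=\{0,1,2,\dots\}$. The bidirectional sequence of gaps is $(y_{k+1}-y_k)_{k\in\mathbb{Z}}$, where $(y_k)_{k\in\mathbb{Z}}$ is the increasing enumeration of $X^{\mathcal{A}}(\alpha)$. Exchange of three intervals: let $0<\lambda\leq\mu<1$ and define $T:[0,1)\to[0,1)$ by $$T(x)=x+1-\lambda \text{ for } x\in I_A:=[0,\lambda),\quad T(x)=x+1-\lambda-\mu \text{ for } x\in I_B:=[\lambda,\mu),\quad T(x)=x-\mu \text{ for } x\in I_C:=[\mu,1).$$ $T$ is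 an exchange of three intervals (if $\lambda=\mu$, the interval $I_B$ is empty and $T$ degenerates to an exchange of two intervals; this degenerate case is admitted). For $\rho\in[0,1)$, the orbit of $\rho$ under $T$ is coded by the bidirectional infinite word $\mathbf{u}=\cdots u_{-2}u_{-1}u_0u_1u_2\cdots$ over $\{A,B,C\}$ given by $u_n=X$ if $T^n(\rho)\in I_X$; such a $\mathbf{u}$ is called a coding of exchange of three intervals (a 3iet word). The gap sequence is regarded as a word over $\{A,B,C\}$ by letting the letters $A$ and $C$ stand for the gap values $\Delta_1$ and $\Delta_2$ (in a suitable order) and the letter $B$ for $\Delta_1+\Delta_2$.
   Formalization: The gap sequence is shown to be a coding of an exchange of three intervals either with the half-open intervals given or with (0,λ), [λ,μ], (μ,1) on (0,1); the half-open form alone fails, e.g. for the golden ratio, α=β, digits -1,0,1, where BB occurs. *)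

theory Defs
  imports Complex_Main
begin

definition larger_root :: "real \<Rightarrow> real \<Rightarrow> real \<Rightarrow> bool" where
  "larger_root b c x \<longleftrightarrow> x\<^sup>2 + b * x + c = 0 \<and> (\<forall>z. z\<^sup>2 + b * z + c = 0 \<longrightarrow> z \<le> x)"

definition quadratic_pisot_unit :: "real \<Rightarrow> bool" where
  "quadratic_pisot_unit \<beta> \<longleftrightarrow> \<beta> > 1 \<and>
     (\<exists>p::int. p \<ge> 1 \<and> larger_root (- of_int p) (- 1) \<beta> \<or>
               p \<ge> 3 \<and> larger_root (- of_int p) 1 \<beta>)"

definition digit_spectrum :: "int set \<Rightarrow> real \<Rightarrow> real set" where
  "digit_spectrum D \<alpha> =
     {\<Sum>j=0..n. of_int (a j) * \<alpha> ^ j | (n::nat) (a::nat \<Rightarrow> int). \<forall>j\<le>n. a j \<in> D}"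

definition consecutive_in :: "real set \<Rightarrow> real \<Rightarrow> real \<Rightarrow> bool" where
  "consecutive_in X x z \<longleftrightarrow> x \<in> X \<and> z \<in> X \<and> x < z \<and> X \<inter> {x<..<z} = {}"

definition increasing_enumeration :: "real set \<Rightarrow> (int \<Rightarrow> real) \<Rightarrow> bool" where
  "increasing_enumeration X y \<longleftrightarrow> strict_mono y \<and> range y = X"

datatype letter = A | B | C

fun iet3_shift :: "real \<Rightarrow> real \<Rightarrow> letter \<Rightarrow> real" where
  "iet3_shift l m A = 1 - l"
| "iet3_shift l m B = 1 - l - m"
| "iet3_shift l m C = - m"

text \<open>
  \<open>iet3_letter\<close> names the interval containing a point of \<open>[0,1)\<close>, for the intervals
  \<open>[0,l)\<close>, \<open>[l,m)\<close>, \<open>[m,1)\<close>; \<open>open_iet3_letter\<close> does so for a point of \<open>(0,1)\<close>, for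
  the intervals \<open>(0,l)\<close>, \<open>[l,m]\<close>, \<open>(m,1)\<close>. The same three translations exchange the
  intervals in both cases. In the second case, \<open>l = m\<close> makes the middle interval a single point.
\<close>

definition iet3_letter :: "real \<Rightarrow> real \<Rightarrow> real \<Rightarrow> letter" where
  "iet3_letter l m x = (if x < l then A else if x < m then B else C)"

definition open_iet3_letter :: "real \<Rightarrow> real \<Rightarrow> real \<Rightarrow> letter" where
  "open_iet3_letter l m x = (if x < l then A else if x \<le> m then B else C)"

definition iet3 :: "real \<Rightarrow> real \<Rightarrow> real \<Rightarrow> real" where
  "iet3 l m x = x + iet3_shift l m (iet3_letter l m x)"

definition open_iet3 :: "real \<Rightarrow> real \<Rightarrow> real \<Rightarrow> real" where
  "open_iet3 l m x = x + iet3_shift l m (open_iet3_letter l m x)"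

lemma bij_betw_iet3:
  assumes "0 < l" "l \<le> m" "m < 1"
  shows "bij_betw (iet3 l m) {0..<1} {0..<1}"
proof (rule bij_betwI')
  fix x y :: real
  assume "x \<in> {0..<1}" "y \<in> {0..<1}"
  then show "iet3 l m x = iet3 l m y \<longleftrightarrow> x = y"
    using assms by (auto simp: iet3_def iet3_letter_def split: if_splits)
next
  fix x :: real
  assume "x \<in> {0..<1}"
  then show "iet3 l m x \<in> {0..<1}"
    using assms by (auto simp: iet3_def iet3_letter_def)
next
  fix y :: real
  assume y: "y \<in> {0..<1}"
  define x where "x = (if y < 1 - m then y + m else if y < 1 - l then y - (1 - l - m) else y - (1 - l))"
  have "x \<in> {0..<1}" "y = iet3 l m x"
    using assms y by (auto simp: x_def iet3_def iet3_letter_def)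
  then show "\<exists>x\<in>{0..<1}. y = iet3 l m x" by blast
qed

lemma bij_betw_open_iet3:
  assumes "0 < l" "l \<le> m" "m < 1"
  shows "bij_betw (open_iet3 l m) {0<..<1} {0<..<1}"
proof (rule bij_betwI')
  fix x y :: real
  assume "x \<in> {0<..<1}" "y \<in> {0<..<1}"
  then show "open_iet3 l m x = open_iet3 l m y \<longleftrightarrow> x = y"
    using assms by (auto simp: open_iet3_def open_iet3_letter_def split: if_splits)
next
  fix x :: real
  assume "x \<in> {0<..<1}"
  then show "open_iet3 l m x \<in> {0<..<1}"
    using assms by (auto simp: open_iet3_def open_iet3_letter_def)
next
  fix y :: real
  assume y: "y \<in> {0<..<1}"
  define x where "x = (if y < 1 - m then y + m else if y \<le> 1 - l then y - (1 - l - m) else y - (1 - l))"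
  have "x \<in> {0<..<1}" "y = open_iet3 l m x"
    using assms y by (auto simp: x_def open_iet3_def open_iet3_letter_def)
  then show "\<exists>x\<in>{0<..<1}. y = open_iet3 l m x" by blast
qed

text \<open>Two-sided iteration of a bijection \<open>f\<close> of \<open>S\<close> onto itself.\<close>

definition int_iterate :: "'a set \<Rightarrow> ('a \<Rightarrow> 'a) \<Rightarrow> int \<Rightarrow> 'a \<Rightarrow> 'a" where
  "int_iterate S f n x =
     (if n \<ge> 0 then (f ^^ nat n) x else (inv_into S f ^^ nat (- n)) x)"

definition iet3_word :: "(int \<Rightarrow> letter) \<Rightarrow> bool" where
  "iet3_word u \<longleftrightarrow> (\<exists>l m \<rho>::real. 0 < l \<and> l \<le> m \<and> m < 1 \<and> \<rho> \<in> {0..<1} \<and>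
     (\<forall>n. u n = iet3_letter l m (int_iterate {0..<1} (iet3 l m) n \<rho>)))"

text \<open>
  The open variant differs from \<open>iet3_word\<close> only on orbits that pass through \<open>m\<close>. It cannot be
  dispensed with for spectra: let \<open>\<beta>\<close> be the golden ratio, \<open>\<alpha> = \<beta>\<close> and the digits
  \<open>-1, 0, 1\<close>. The spectrum consists of the \<open>x\<close> in \<open>\<int>[\<beta>]\<close> whose conjugate lies in the
  open interval \<open>(-\<beta>\<^sup>2, \<beta>\<^sup>2)\<close>, the endpoints of which are conjugates of elements of \<open>\<int>[\<beta>]\<close>.
  Both gaps next to \<open>0\<close> are equal to \<open>\<beta> - 1\<close>, the sum of the other two gap values, so that the
  gap word contains \<open>BB\<close>. The frequencies of the letters determine \<open>l\<close> and \<open>m\<close>, and with these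
  values the half-open interval \<open>[l, m)\<close> is disjoint from its image, so that no \<open>iet3_word\<close> with
  these frequencies contains \<open>BB\<close>.
\<close>

definition open_iet3_word :: "(int \<Rightarrow> letter) \<Rightarrow> bool" where
  "open_iet3_word u \<longleftrightarrow> (\<exists>l m \<rho>::real. 0 < l \<and> l \<le> m \<and> m < 1 \<and> \<rho> \<in> {0<..<1} \<and>
     (\<forall>n. u n = open_iet3_letter l m (int_iterate {0<..<1} (open_iet3 l m) n \<rho>)))"

fun gap_value :: "real \<Rightarrow> real \<Rightarrow> letter \<Rightarrow> real" where
  "gap_value a c A = a"
| "gap_value a c B = a + c"
| "gap_value a c C = c"

end

theory Submission
  imports Defs
begin

text \<open>
  Let \<open>\<beta>'\<close> be the conjugate of \<open>\<beta>\<close> and \<open>\<gamma> = \<plusminus>\<beta>'\<close> that of \<open>\<alpha> = \<plusminus>\<beta>\<close>. A point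
  \<open>x = \<Sum> a\<^sub>j \<alpha>\<^sup>j\<close> of the spectrum is viewed as the first coordinate of \<open>(x, y)\<close> with
  \<open>y = \<Sum> a\<^sub>j \<gamma>\<^sup>j\<close>, a point of the lattice that represents \<open>\<int>[\<beta>]\<close> in the plane. Since
  \<open>\<bar>\<gamma>\<bar> = 1 / \<beta> < 1\<close>, the second coordinates stay in a bounded interval, the window. The theorem rests
  on two facts.

  The spectrum is a cut-and-project set: it consists of the first coordinates of \<^emph>\<open>all\<close> lattice points
  over the window. To expand a given lattice point, digits are stripped off by
  \<open>(x, y) \<mapsto> ((x - a) / \<alpha>, (y - a) / \<gamma>)\<close>, which preserves the lattice because \<open>\<alpha>\<close> is a unit. As
  there are more than \<open>\<beta>\<close> digits, \<open>a\<close> can be chosen such that \<open>y\<close> stays in the window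
  (\<open>ex_digit_in_window\<close>), while \<open>x\<close> contracts towards a bounded interval. This leaves finitely many
  lattice points (\<open>fills_if_residual\<close>). If the number of digits is as small as possible, they are
  \<open>0\<close> and at most a few units with evident expansions; from there the number of digits is increased
  one by one (\<open>fills_enlarge\<close>). The condition on the digits \<open>\<plusminus>1\<close> for \<open>\<alpha> = \<beta>\<close> is needed because
  with digits of one sign the spectrum would be bounded on one side.

  The gaps of a cut-and-project set with an interval as window are coded by an exchange of three
  intervals (\<open>cut_and_project_coding\<close>). With the window scaled to length one, \<open>\<Delta>\<^sub>1\<close> is the shortest
  step to the right that moves up by less than one in the window, \<open>\<Delta>\<^sub>2\<close> the shortest one that moves
  down by less than one. A point with a low second coordinate is followed after \<open>\<Delta>\<^sub>1\<close>, one with a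
  high second coordinate after \<open>\<Delta>\<^sub>2\<close>, and one in the middle, where neither step stays in the window,
  after \<open>\<Delta>\<^sub>1 + \<Delta>\<^sub>2\<close>. The second coordinate is thereby moved by the exchange. The window is open,
  except that it contains \<open>0\<close> if \<open>0\<close> is one of its ends; this decides between the half-open and
  the open form of the exchange.
\<close>

section \<open>Two-sided orbits and increasing enumerations\<close>

lemma iterates_eq_int_iterate:
  fixes r :: "int \<Rightarrow> 'a"
  assumes bij: "bij_betw f S S" and r: "\<And>k. r k \<in> S" and step: "\<And>k. r (k + 1) = f (r k)"
  shows "r k = int_iterate S f k (r 0)"
proof (cases "k \<ge> 0")
  case True
  have "r (int n) = (f ^^ n) (r 0)" for n
    by (induction n) (use step[of "int _"] in \<open>auto simp: add.commute\<close>)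
  from this[of "nat k"] True show ?thesis by (simp add: int_iterate_def)
next
  case False
  have "r (- int n) = (inv_into S f ^^ n) (r 0)" for n
  proof (induction n)
    case (Suc n)
    have "r (- int n) = f (r (- int (Suc n)))"
      using step[of "- int (Suc n)"] by simp
    then have "inv_into S f (r (- int n)) = r (- int (Suc n))"
      using bij r by (simp add: bij_betw_def)
    with Suc show ?case by simp
  qed simp
  from this[of "nat (- k)"] False show ?thesis by (simp add: int_iterate_def)
qed

lemma strict_mono_intI:
  fixes y :: "int \<Rightarrow> real"
  assumes "\<And>k. y k < y (k + 1)"
  shows "strict_mono y"
proof (rule strict_monoI)
  fix j k :: int
  assume "j < k"
  then show "y j < y k"
  proof (induction k rule: int_gr_induct)
    case base then show ?case using assms[of j] by simp
  next
    case (step i) then show ?case using assms[of i] by simp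
  qed
qed

text \<open>
  The successor and predecessor maps run through the set from \<open>x0\<close>. As every gap is at least
  \<open>\<delta>\<close>, the points escape to infinity in both directions, so that each point of \<open>X\<close> is caught
  between two neighbours of the enumeration and hence equals one of them.
\<close>

lemma ex_increasing_enumeration:
  assumes "x0 \<in> X" and \<delta>: "\<delta> > 0"
    and succ: "\<And>x. x \<in> X \<Longrightarrow> \<exists>z. consecutive_in X x z"
    and pred: "\<And>z. z \<in> X \<Longrightarrow> \<exists>x. consecutive_in X x z"
    and gap: "\<And>x z. consecutive_in X x z \<Longrightarrow> z - x \<ge> \<delta>"
  shows "\<exists>y. increasing_enumeration X y"
proof -
  obtain s where s: "\<And>x. x \<in> X \<Longrightarrow> consecutive_in X x (s x)" using succ by metis
  obtain q where q: "\<And>x. x \<in> X \<Longrightarrow> consecutive_in X (q x) x" using pred by metis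
  have mem: "consecutive_in X x z \<Longrightarrow> x \<in> X \<and> z \<in> X" for x z
    by (simp add: consecutive_in_def)
  define y where "y k = (if k \<ge> 0 then (s ^^ nat k) x0 else (q ^^ nat (- k)) x0)" for k :: int
  have sX: "(s ^^ n) x0 \<in> X" for n by (induction n) (use assms(1) s mem in auto)
  have qX: "(q ^^ n) x0 \<in> X" for n by (induction n) (use assms(1) q mem in auto)
  have yX: "y k \<in> X" for k by (simp add: y_def sX qX)
  have cons: "consecutive_in X (y k) (y (k + 1))" for k
  proof (cases "k \<ge> 0")
    case True
    then have "nat (k + 1) = Suc (nat k)" by simp
    with True s[OF sX[of "nat k"]] show ?thesis by (simp add: y_def)
  next
    case False
    then have "nat (- k) = Suc (nat (- (k + 1)))" by simp
    moreover have "y (k + 1) = (q ^^ nat (- (k + 1))) x0"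
      using False by (cases "k = -1") (auto simp: y_def)
    ultimately show ?thesis using False q[OF qX[of "nat (- (k + 1))"]] by (simp add: y_def)
  qed
  have mono: "strict_mono y"
    by (rule strict_mono_intI) (use cons in \<open>auto simp: consecutive_in_def\<close>)
  have grow: "y (int n) \<ge> x0 + n * \<delta> \<and> y (- int n) \<le> x0 - n * \<delta>" for n
  proof (induction n)
    case (Suc n)
    have "y (int n + 1) - y (int n) \<ge> \<delta>" "y (- int (Suc n) + 1) - y (- int (Suc n)) \<ge> \<delta>"
      using gap cons by blast+
    with Suc show ?case by (simp add: algebra_simps)
  qed (simp add: y_def)
  have "z \<in> range y" if z: "z \<in> X" for z
  proof -
    obtain n :: nat where n: "\<bar>z - x0\<bar> < n * \<delta>" using reals_Archimedean3[OF \<delta>] by blast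
    have lo: "y (- int n) \<le> z" and hi: "z < y (int n)"
      using grow[of n] n by (auto simp: abs_if split: if_splits)
    have "\<exists>k. y k \<le> z \<and> z < y (k + 1)"
    proof (rule ccontr)
      assume "\<not> ?thesis"
      then have no: "y k \<le> z \<Longrightarrow> y (k + 1) \<le> z" for k by force
      have "y (- int n + int j) \<le> z" for j
      proof (induction j)
        case (Suc j) then show ?case using no[of "- int n + int j"] by (simp add: algebra_simps)
      qed (use lo in simp)
      from this[of "2 * n"] hi show False by simp
    qed
    then obtain k where k: "y k \<le> z" "z < y (k + 1)" by blast
    then have "z = y k" using cons[of k] z by (force simp: consecutive_in_def)
    then show ?thesis by blast
  qed
  then have "increasing_enumeration X y"
    using mono yX by (auto simp: increasing_enumeration_def)
  then show ?thesis by blast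
qed

lemma increasing_enumeration_consecutive:
  assumes "increasing_enumeration X y"
  shows "consecutive_in X (y k) (y (k + 1))"
proof -
  have mono: "strict_mono y" and X: "X = range y" using assms by (auto simp: increasing_enumeration_def)
  have "\<not> (y k < y j \<and> y j < y (k + 1))" for j
    using strict_mono_less[OF mono] by force
  then show ?thesis
    using strict_monoD[OF mono, of k "k + 1"] X by (auto simp: consecutive_in_def)
qed

lemma consecutive_in_unique:
  "consecutive_in X x z \<Longrightarrow> consecutive_in X x z' \<Longrightarrow> z = z'"
  unfolding consecutive_in_def by (metis disjoint_iff greaterThanLessThan_iff linorder_cases)

section \<open>Gaps of cut-and-project sets\<close>

text \<open>
  The half-open and the open form of the exchange are treated together from here on. What is used
  of them is that the exchange is a bijection of the window and the three inequalities of
  \<open>coding_window_moves\<close> below.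
\<close>

definition coding_window :: "real \<Rightarrow> real \<Rightarrow> real set \<Rightarrow> (real \<Rightarrow> letter) \<Rightarrow> bool" where
  "coding_window l m W f \<longleftrightarrow> W = {0..<1} \<and> f = iet3_letter l m \<or>
                           W = {0<..<1} \<and> f = open_iet3_letter l m"

lemma coding_window_bij:
  assumes "0 < l" "l \<le> m" "m < 1" "coding_window l m W f"
  shows "bij_betw (\<lambda>r. r + iet3_shift l m (f r)) W W"
  using bij_betw_iet3[OF assms(1-3)] bij_betw_open_iet3[OF assms(1-3)] assms(4)
  by (auto simp: coding_window_def iet3_def[abs_def] open_iet3_def[abs_def])

lemma coding_window_word:
  assumes "0 < l" "l \<le> m" "m < 1" "coding_window l m W f" "\<rho> \<in> W"
    and "\<And>n. u n = f (int_iterate W (\<lambda>r. r + iet3_shift l m (f r)) n \<rho>)"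
  shows "iet3_word u \<or> open_iet3_word u"
proof -
  from assms(4) consider "W = {0..<1}" "f = iet3_letter l m" | "W = {0<..<1}" "f = open_iet3_letter l m"
    unfolding coding_window_def by blast
  then show ?thesis
  proof cases
    case 1
    then have "iet3_word u" using assms unfolding iet3_word_def iet3_def[abs_def] by blast
    then show ?thesis ..
  next
    case 2
    then have "open_iet3_word u" using assms unfolding open_iet3_word_def open_iet3_def[abs_def] by blast
    then show ?thesis ..
  qed
qed

text \<open>
  From a point coded \<open>C\<close> one cannot move up by as much as \<open>1 - l\<close> inside the window, from a
  point coded \<open>A\<close> one cannot move down by as much as \<open>m\<close>, and from a point coded \<open>B\<close> neither
  is possible. This is all that the proof of the coding uses about the letters.
\<close>

lemma coding_window_moves:
  assumes "0 < l" "l \<le> m" "m < 1" "coding_window l m W f" "r \<in> W" "r' \<in> W"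
  shows "\<bar>r' - r\<bar> < 1" and "f r \<noteq> C \<Longrightarrow> r' - r > - m" and "f r \<noteq> A \<Longrightarrow> r' - r < 1 - l"
  using assms by (auto simp: coding_window_def iet3_letter_def open_iet3_letter_def split: if_splits)

text \<open>
  The first coordinate of a pair is the physical one, the second is scaled so that the window has
  length one. The last two axioms provide steps to the right that move up, or down, inside the
  window.
\<close>

locale planar_lattice =
  fixes L :: "(real \<times> real) set"
  assumes diff_closed: "(x, y) \<in> L \<Longrightarrow> (u, v) \<in> L \<Longrightarrow> (x - u, y - v) \<in> L"
    and finite_strip: "finite {z \<in> L. \<bar>fst z\<bar> \<le> c \<and> \<bar>snd z\<bar> \<le> 1}"
    and fst_zero: "(0, y) \<in> L \<Longrightarrow> y = 0"
    and snd_zero: "(x, 0) \<in> L \<Longrightarrow> x = 0"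
    and ex_up: "\<exists>x y. (x, y) \<in> L \<and> 0 < x \<and> 0 < y \<and> y < 1"
    and ex_down: "\<exists>x y. (x, y) \<in> L \<and> 0 < x \<and> - 1 < y \<and> y < 0"
begin

lemma add_closed:
  assumes "(x, y) \<in> L" "(u, v) \<in> L"
  shows "(x + u, y + v) \<in> L"
proof -
  have "(0 - u, 0 - v) \<in> L" using diff_closed[OF assms(2) assms(2)] diff_closed assms(2) by fastforce
  from diff_closed[OF assms(1) this] show ?thesis by simp
qed

lemma ex_least_step:
  assumes "(x0, y0) \<in> L" "0 < x0" "P y0" and P: "\<And>y. P y \<Longrightarrow> \<bar>y\<bar> \<le> 1"
  obtains d e where "(d, e) \<in> L" "0 < d" "P e" "\<And>x y. (x, y) \<in> L \<Longrightarrow> 0 < x \<Longrightarrow> P y \<Longrightarrow> d \<le> x"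
proof -
  define S where "S = {z \<in> L. 0 < fst z \<and> fst z \<le> x0 \<and> P (snd z)}"
  have "finite S"
    by (rule finite_subset[OF _ finite_strip[of x0]]) (use P in \<open>auto simp: S_def\<close>)
  moreover have "(x0, y0) \<in> S" using assms by (simp add: S_def)
  ultimately obtain z where z: "z \<in> S" and min: "\<And>w. w \<in> S \<Longrightarrow> fst z \<le> fst w"
    using arg_min_if_finite(1)[of S fst] arg_min_if_finite(2)[of S fst]
    by (metis empty_iff not_less)
  show ?thesis
  proof (rule that[of "fst z" "snd z"])
    fix x y assume "(x, y) \<in> L" "0 < x" "P y"
    then show "fst z \<le> x" using min[of "(x, y)"] z by (cases "x \<le> x0") (auto simp: S_def)
  qed (use z in \<open>auto simp: S_def\<close>)
qed

text \<open>
  The two steps are the shortest one with \<open>0 < y < 1\<close> and the shortest one with \<open>-1 < y < 0\<close>.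
  Their minimality forces \<open>l \<le> m\<close>: otherwise the difference of the two vectors, with the sign that
  makes its first coordinate positive, would again be a vector of one of the two kinds, shorter than
  the shortest.
\<close>

lemma ex_interval_exchange_steps:
  obtains d1 d2 l m where "0 < d1" "0 < d2" "0 < l" "l \<le> m" "m < 1" "(d1, 1 - l) \<in> L" "(d2, - m) \<in> L"
    "\<And>x y. (x, y) \<in> L \<Longrightarrow> 0 < x \<Longrightarrow> 0 < y \<Longrightarrow> y < 1 \<Longrightarrow> d1 \<le> x"
    "\<And>x y. (x, y) \<in> L \<Longrightarrow> 0 < x \<Longrightarrow> - 1 < y \<Longrightarrow> y < 0 \<Longrightarrow> d2 \<le> x"
proof -
  obtain d1 e1 where 1: "(d1, e1) \<in> L" "0 < d1" "0 < e1 \<and> e1 < 1"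
    and min1: "\<And>x y. (x, y) \<in> L \<Longrightarrow> 0 < x \<Longrightarrow> 0 < y \<and> y < 1 \<Longrightarrow> d1 \<le> x"
    using ex_up ex_least_step[where P = "\<lambda>y. 0 < y \<and> y < 1"] by (smt (verit))
  obtain d2 e2 where 2: "(d2, e2) \<in> L" "0 < d2" "- 1 < e2 \<and> e2 < 0"
    and min2: "\<And>x y. (x, y) \<in> L \<Longrightarrow> 0 < x \<Longrightarrow> - 1 < y \<and> y < 0 \<Longrightarrow> d2 \<le> x"
    using ex_down ex_least_step[where P = "\<lambda>y. - 1 < y \<and> y < 0"] by (smt (verit))
  have "e1 - e2 \<ge> 1"
  proof (rule ccontr)
    assume small: "\<not> e1 - e2 \<ge> 1"
    have 12: "(d1 - d2, e1 - e2) \<in> L" and 21: "(d2 - d1, e2 - e1) \<in> L"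
      using diff_closed 1 2 by blast+
    consider "d1 < d2" | "d2 < d1" | "d1 = d2" by linarith
    then show False
    proof cases
      case 1 then show False using min2[OF 21] small \<open>0 < d1\<close> 2 \<open>0 < e1 \<and> e1 < 1\<close> by linarith
    next
      case 2 then show False using min1[OF 12] small \<open>0 < d2\<close> \<open>-1 < e2 \<and> e2 < 0\<close> 1 by linarith
    next
      case 3 then show False using fst_zero[of "e1 - e2"] 12 1 2 by simp
    qed
  qed
  then show ?thesis using that[of d1 d2 "1 - e1" "- e2"] 1 2 min1 min2 by simp
qed

text \<open>
  A point with window coordinate \<open>r\<close> can make the step \<open>d1\<close>, which raises \<open>r\<close> by \<open>1 - l\<close>, if
  \<open>r\<close> is low; the step \<open>d2\<close>, which lowers \<open>r\<close> by \<open>m\<close>, if \<open>r\<close> is high; and in the middle only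
  both steps together. No shorter step exists, since a lattice vector whose second coordinate lies
  strictly between \<open>-m\<close> and \<open>1 - l\<close> remains a step to the right after \<open>d1\<close> or \<open>d2\<close> is subtracted
  from it. Hence the window coordinates of consecutive points form an orbit of the exchange.
\<close>

lemma cut_and_project_coding:
  assumes X: "X = {x. \<exists>y. (x, y) \<in> L \<and> y + t \<in> W}" and "X \<noteq> {}"
    and W: "W = {0..<1} \<or> W = {0<..<1}"
  shows "\<exists>\<Delta>\<^sub>1 \<Delta>\<^sub>2. \<Delta>\<^sub>1 > 0 \<and> \<Delta>\<^sub>2 > 0 \<and>
    (\<forall>x z. consecutive_in X x z \<longrightarrow> z - x \<in> {\<Delta>\<^sub>1, \<Delta>\<^sub>2, \<Delta>\<^sub>1 + \<Delta>\<^sub>2}) \<and>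
    (\<exists>y. increasing_enumeration X y) \<and>
    (\<forall>y. increasing_enumeration X y \<longrightarrow>
      (\<exists>u. (\<forall>k. y (k + 1) - y k = gap_value \<Delta>\<^sub>1 \<Delta>\<^sub>2 (u k)) \<and> (iet3_word u \<or> open_iet3_word u)))"
proof -
  obtain d1 d2 l m where d: "0 < d1" "0 < d2" and lm: "0 < l" "l \<le> m" "m < 1"
    and L1: "(d1, 1 - l) \<in> L" and L2: "(d2, - m) \<in> L"
    and up: "\<And>x y. (x, y) \<in> L \<Longrightarrow> 0 < x \<Longrightarrow> 0 < y \<Longrightarrow> y < 1 \<Longrightarrow> d1 \<le> x"
    and down: "\<And>x y. (x, y) \<in> L \<Longrightarrow> 0 < x \<Longrightarrow> - 1 < y \<Longrightarrow> y < 0 \<Longrightarrow> d2 \<le> x"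
    by (rule ex_interval_exchange_steps) blast
  obtain f where f: "coding_window l m W f" using W by (auto simp: coding_window_def)
  define T where "T r = r + iet3_shift l m (f r)" for r
  have bij: "bij_betw T W W" using coding_window_bij[OF lm f] by (simp add: T_def[abs_def])
  have T: "T r \<in> W" if "r \<in> W" for r using bij that by (auto simp: bij_betw_def)
  define gap where "gap r = gap_value d1 d2 (f r)" for r
  (* A step to the right with nonzero second coordinate in (-m, 1 - l) is at least as long as d1 and d2
     together: subtracting the one on its own side leaves a step on the other side, no shorter than the
     other one. *)
  have far: "d1 + d2 \<le> x" if "(x, y) \<in> L" "0 < x" "- m < y" "y < 1 - l" "y \<noteq> 0" for x y
  proof (cases "0 < y")
    case True
    have "(x - d1, y - (1 - l)) \<in> L" using diff_closed that L1 by blast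
    moreover have "d1 \<le> x" using up that True lm by auto
    moreover have "x - d1 \<noteq> 0" using calculation fst_zero[of "y - (1 - l)"] that by auto
    ultimately show ?thesis using down[of "x - d1" "y - (1 - l)"] that True lm by auto
  next
    case False
    have "(x - d2, y - (- m)) \<in> L" using diff_closed that L2 by blast
    moreover have "d2 \<le> x" using down that False lm by auto
    moreover have "x - d2 \<noteq> 0" using calculation fst_zero[of "y + m"] that by auto
    ultimately show ?thesis using up[of "x - d2" "y + m"] that False lm by auto
  qed
  have gapL: "(gap r, iet3_shift l m (f r)) \<in> L" for r
    using add_closed[OF L1 L2] L1 L2 by (cases "f r") (auto simp: gap_def)
  have gap_pos: "gap r > 0" for r using d by (cases "f r") (auto simp: gap_def)
  have next_point: "consecutive_in X x (x + gap (y + t)) \<and> (x + gap (y + t), T (y + t) - t) \<in> L"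
    if xy: "(x, y) \<in> L" "y + t \<in> W" for x y
  proof -
    define r where "r = y + t"
    have new: "(x + gap r, T r - t) \<in> L"
      using add_closed[OF xy(1) gapL[of r]] by (simp add: T_def r_def algebra_simps)
    have "False" if x': "(x', y') \<in> L" "y' + t \<in> W" "x < x'" "x' < x + gap r" for x' y'
    proof -
      define g h where "g = x' - x" and "h = y' - y"
      have gh: "(g, h) \<in> L" "0 < g" "g < gap r"
        using diff_closed[OF x'(1) xy(1)] x' by (auto simp: g_def h_def)
      have h: "h = (y' + t) - r" by (simp add: h_def r_def)
      have h0: "h \<noteq> 0" using snd_zero gh by auto
      have r: "r \<in> W" using xy by (simp add: r_def)
      note mv = coding_window_moves[OF lm f r x'(2), folded h]
      show False
      proof (cases "f r")
        case A
        then have "g < d1" using gh by (simp add: gap_def)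
        then have "h < 0" using up[OF gh(1,2)] mv(1) h0 by linarith
        then show False using far[OF gh(1,2)] mv(2) A \<open>g < d1\<close> lm d h0 by simp
      next
        case B
        then show False using far[OF gh(1,2)] mv(2,3) gh h0 by (simp add: gap_def)
      next
        case C
        then have "g < d2" using gh by (simp add: gap_def)
        then have "h > 0" using down[OF gh(1,2)] mv(1) h0 by linarith
        then show False using far[OF gh(1,2)] mv(3) C \<open>g < d2\<close> lm d h0 by simp
      qed
    qed
    moreover have "x \<in> X" "x + gap r \<in> X"
      using xy new T[of r] unfolding X r_def by auto
    ultimately have "consecutive_in X x (x + gap r)"
      using gap_pos[of r] unfolding consecutive_in_def X by auto
    with new show ?thesis by (simp add: r_def)
  qed
  have gap_eq: "z - x \<in> {d1, d2, d1 + d2}" if xz: "consecutive_in X x z" for x z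
  proof -
    obtain y where y: "(x, y) \<in> L" "y + t \<in> W" using xz unfolding consecutive_in_def X by blast
    then have "z = x + gap (y + t)" using consecutive_in_unique[OF xz] next_point by blast
    then show ?thesis by (cases "f (y + t)") (auto simp: gap_def)
  qed
  have "\<exists>y. increasing_enumeration X y"
  proof -
    obtain x0 where "x0 \<in> X" using \<open>X \<noteq> {}\<close> by blast
    then show ?thesis
    proof (rule ex_increasing_enumeration[where \<delta> = "min d1 d2"])
      show "\<exists>z. consecutive_in X x z" if "x \<in> X" for x using that next_point unfolding X by blast
      show "\<exists>x. consecutive_in X x z" if z: "z \<in> X" for z
      proof -
        obtain y where y: "(z, y) \<in> L" "y + t \<in> W" using z X by auto
        (* The predecessor of z is found by inverting the exchange. *)
        obtain r where r: "r \<in> W" "T r = y + t" using bij y(2) by (metis bij_betw_def imageE)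
        have "y - iet3_shift l m (f r) = r - t" using r(2) by (simp add: T_def)
        then have "(z - gap r, r - t) \<in> L" using diff_closed[OF y(1) gapL[of r]] by simp
        then have "consecutive_in X (z - gap r) z" using next_point r(1) by fastforce
        then show ?thesis ..
      qed
      show "min d1 d2 \<le> z - x" if "consecutive_in X x z" for x z using gap_eq[OF that] d by auto
    qed (use d in auto)
  qed
  moreover have "\<exists>u. (\<forall>k. y (k + 1) - y k = gap_value d1 d2 (u k)) \<and> (iet3_word u \<or> open_iet3_word u)"
    if y: "increasing_enumeration X y" for y
  proof -
    have "\<exists>v. (y k, v) \<in> L \<and> v + t \<in> W" for k
      using y X by (auto simp: increasing_enumeration_def)
    then obtain v where v: "\<And>k. (y k, v k) \<in> L" "\<And>k. v k + t \<in> W" by metis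
    have step: "y (k + 1) = y k + gap (v k + t) \<and> v (k + 1) + t = T (v k + t)" for k
    proof -
      note n = next_point[OF v(1) v(2), of k]
      have "y (k + 1) = y k + gap (v k + t)"
        using n consecutive_in_unique increasing_enumeration_consecutive[OF y] by blast
      moreover from this have "(0, v (k + 1) - (T (v k + t) - t)) \<in> L"
        using diff_closed[OF v(1)[of "k + 1"] conjunct2[OF n]] by simp
      ultimately show ?thesis using fst_zero by force
    qed
    have orbit: "v k + t = int_iterate W T k (v 0 + t)" for k
      by (rule iterates_eq_int_iterate[OF bij]) (use v(2) conjunct2[OF step] in blast)+
    define u where "u k = f (v k + t)" for k
    have "y (k + 1) - y k = gap_value d1 d2 (u k)" for k
      using step[of k] by (simp add: u_def gap_def)
    moreover have "u n = f (int_iterate W T n (v 0 + t))" for n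
      unfolding u_def by (rule arg_cong[OF orbit])
    then have "iet3_word u \<or> open_iet3_word u"
      using coding_window_word[OF lm f v(2)[of 0]] by (simp add: T_def[abs_def])
    ultimately show ?thesis by blast
  qed
  ultimately show ?thesis using d gap_eq by blast
qed

end

section \<open>The planar lattice of a quadratic unit\<close>

text \<open>
  \<open>\<beta>'\<close> is the algebraic conjugate of the quadratic unit \<open>\<beta>\<close>, with trace \<open>p\<close> and norm \<open>\<tau>\<close>.
\<close>

locale quadratic_unit =
  fixes \<beta> \<beta>' :: real and p \<tau> :: int
  assumes gt1: "\<beta> > 1" and trace: "\<beta> + \<beta>' = p" and norm: "\<beta> * \<beta>' = \<tau>"
    and sign: "\<tau> = - 1 \<and> p \<ge> 1 \<or> \<tau> = 1 \<and> p \<ge> 3"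
begin

text \<open>
  The image of \<open>\<int>[\<beta>]\<close> in the plane under \<open>x \<mapsto> (x, x')\<close>. Working with pairs avoids the conjugation
  map.
\<close>

definition lattice :: "(real \<times> real) set" where
  "lattice = {(a + b * \<beta>, a + b * \<beta>') | a b. a \<in> \<int> \<and> b \<in> \<int>}"

lemma conj_eq: "\<beta>' = \<tau> / \<beta>"
  using norm gt1 by (simp add: field_simps)

lemma abs_conj: "\<bar>\<beta>'\<bar> = 1 / \<beta>"
  using conj_eq sign gt1 by auto

lemma inverse_eq: "1 / \<beta> = \<tau> * (p - \<beta>)"
proof -
  have "p - \<beta> = \<beta>'" using trace by simp
  then have "\<tau> * (p - \<beta>) = \<tau> * (\<tau> / \<beta>)" by (simp add: conj_eq)
  also have "\<dots> = 1 / \<beta>" using sign by auto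
  finally show ?thesis by simp
qed

lemma conj_inverse_eq: "1 / \<beta>' = \<tau> * (p - \<beta>')"
proof -
  have "\<beta>' \<noteq> 0" using conj_eq sign gt1 by auto
  then have "1 / \<beta>' = \<tau> * (\<tau> / \<beta>')" using sign by auto
  also have "\<tau> / \<beta>' = p - \<beta>'" using norm \<open>\<beta>' \<noteq> 0\<close> by (simp flip: trace norm)
  finally show ?thesis .
qed

lemma square: "\<beta>\<^sup>2 = p * \<beta> - \<tau>"
proof -
  have "\<beta> * (\<beta> + \<beta>') = \<beta> * p" using trace by simp
  then show ?thesis using norm by (simp add: algebra_simps power2_eq_square)
qed

lemma conj_square: "\<beta>'\<^sup>2 = p * \<beta>' - \<tau>"
proof -
  have "\<beta>' * (\<beta> + \<beta>') = \<beta>' * p" using trace by simp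
  then show ?thesis using norm by (simp add: algebra_simps power2_eq_square)
qed

lemma beta_bounds: "\<tau> = - 1 \<Longrightarrow> p < \<beta> \<and> \<beta> < p + 1" "\<tau> = 1 \<Longrightarrow> p - 1 < \<beta> \<and> \<beta> < p"
proof -
  have b: "0 < 1 / \<beta>" "1 / \<beta> < 1" using gt1 by auto
  show "p < \<beta> \<and> \<beta> < p + 1" if "\<tau> = - 1"
  proof -
    have "\<beta>' = - (1 / \<beta>)" using conj_eq that by simp
    then show ?thesis using b trace by linarith
  qed
  show "p - 1 < \<beta> \<and> \<beta> < p" if "\<tau> = 1"
  proof -
    have "\<beta>' = 1 / \<beta>" using conj_eq that by simp
    then show ?thesis using b trace by linarith
  qed
qed

lemma lattice_mem: "a \<in> \<int> \<Longrightarrow> b \<in> \<int> \<Longrightarrow> (a + b * \<beta>, a + b * \<beta>') \<in> lattice"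
  unfolding lattice_def by blast

lemma lattice_int: "a \<in> \<int> \<Longrightarrow> (a, a) \<in> lattice"
  using lattice_mem[of a 0] by simp

lemma latticeE:
  assumes "(x, y) \<in> lattice"
  obtains a b :: int where "x = a + b * \<beta>" "y = a + b * \<beta>'"
  using assms unfolding lattice_def by (auto elim!: Ints_cases)

lemma lattice_diff: "(x, y) \<in> lattice \<Longrightarrow> (u, v) \<in> lattice \<Longrightarrow> (x - u, y - v) \<in> lattice"
proof -
  assume "(x, y) \<in> lattice" "(u, v) \<in> lattice"
  then obtain a b c d :: int where eq: "x = a + b * \<beta>" "y = a + b * \<beta>'" "u = c + d * \<beta>" "v = c + d * \<beta>'"
    by (metis latticeE)
  show ?thesis using lattice_mem[of "of_int (a - c)" "of_int (b - d)"] eq by (simp add: algebra_simps)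
qed

lemma lattice_uminus: "(x, y) \<in> lattice \<Longrightarrow> (- x, - y) \<in> lattice"
  using lattice_diff[of 0 0 x y] lattice_int[of 0] by simp

lemma lattice_add: "(x, y) \<in> lattice \<Longrightarrow> (u, v) \<in> lattice \<Longrightarrow> (x + u, y + v) \<in> lattice"
  using lattice_diff[of x y "- u" "- v"] lattice_uminus by simp

lemma lattice_mult: "(x, y) \<in> lattice \<Longrightarrow> (\<beta> * x, \<beta>' * y) \<in> lattice"
proof -
  assume "(x, y) \<in> lattice"
  then obtain a b :: int where eq: "x = a + b * \<beta>" "y = a + b * \<beta>'" by (rule latticeE)
  have "\<beta> * x = of_int (- b * \<tau>) + of_int (a + b * p) * \<beta>"
    "\<beta>' * y = of_int (- b * \<tau>) + of_int (a + b * p) * \<beta>'"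
    using arg_cong[OF square, of "(*) b"] arg_cong[OF conj_square, of "(*) b"]
    by (simp_all add: eq algebra_simps power2_eq_square)
  then show ?thesis using lattice_mem[of "of_int (- b * \<tau>)" "of_int (a + b * p)"] by simp
qed

lemma lattice_div: "(x, y) \<in> lattice \<Longrightarrow> (x / \<beta>, y / \<beta>') \<in> lattice"
proof -
  assume xy: "(x, y) \<in> lattice"
  then obtain a b :: int where eq: "x = a + b * \<beta>" "y = a + b * \<beta>'" by (rule latticeE)
  have nz: "\<beta> \<noteq> 0" "\<beta>' \<noteq> 0" using gt1 sign conj_eq by auto
  have "x / \<beta> = a * (1 / \<beta>) + b" "y / \<beta>' = a * (1 / \<beta>') + b" using eq nz by (auto simp: field_simps)
  then have "x / \<beta> = of_int (a * \<tau> * p + b) + of_int (- a * \<tau>) * \<beta>"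
    "y / \<beta>' = of_int (a * \<tau> * p + b) + of_int (- a * \<tau>) * \<beta>'"
    unfolding inverse_eq conj_inverse_eq by (auto simp: algebra_simps)
  then show ?thesis using lattice_mem[of "of_int (a * \<tau> * p + b)" "of_int (- a * \<tau>)"] by simp
qed

lemma conj_less: "\<beta>' < 1"
proof -
  have "\<bar>\<beta>'\<bar> < 1" using gt1 by (simp add: abs_conj)
  then show ?thesis by simp
qed

lemma finite_lattice_box: "finite {z \<in> lattice. \<bar>fst z\<bar> \<le> r \<and> \<bar>snd z\<bar> \<le> r'}"
proof -
  define K where "K = (r + r') / (\<beta> - \<beta>')"
  define N where "N = \<lceil>K\<rceil>"
  define M where "M = \<lceil>r + N * \<beta>\<rceil>"
  have pos: "\<beta> - \<beta>' > 0" using gt1 conj_less by simp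
  have "{z \<in> lattice. \<bar>fst z\<bar> \<le> r \<and> \<bar>snd z\<bar> \<le> r'} \<subseteq>
      (\<lambda>(a, b). (of_int a + of_int b * \<beta>, of_int a + of_int b * \<beta>')) ` ({- M..M} \<times> {- N..N})"
  proof
    fix z assume z: "z \<in> {z \<in> lattice. \<bar>fst z\<bar> \<le> r \<and> \<bar>snd z\<bar> \<le> r'}"
    then obtain a b :: int where eq: "z = (a + b * \<beta>, a + b * \<beta>')"
      by (cases z) (auto elim: latticeE)
    have "\<bar>b * (\<beta> - \<beta>')\<bar> \<le> r + r'" using z eq by (auto simp: algebra_simps)
    then have "\<bar>b\<bar> \<le> K" using pos by (simp add: K_def field_simps abs_mult)
    then have b: "\<bar>b\<bar> \<le> N" unfolding N_def by linarith
    then have "\<bar>b * \<beta>\<bar> \<le> N * \<beta>" using gt1 by (simp add: abs_mult)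
    then have "\<bar>a\<bar> \<le> r + N * \<beta>" using z eq by auto
    then have "\<bar>a\<bar> \<le> M" unfolding M_def by linarith
    then show "z \<in> (\<lambda>(a, b). (of_int a + of_int b * \<beta>, of_int a + of_int b * \<beta>')) ` ({- M..M} \<times> {- N..N})"
      using eq b by (intro image_eqI[of _ _ "(a, b)"]) auto
  qed
  then show ?thesis by (rule finite_subset) simp
qed

text \<open>
  The two coordinates of \<open>a + b\<beta>\<close> differ by \<open>b(\<beta> - \<beta>')\<close>, which in this box is less than
  \<open>1 + \<beta> \<le> 2(\<beta> - \<beta>')\<close>. So \<open>b \<in> {-1, 0, 1}\<close>, and for \<open>b = \<plusminus>1\<close> the box leaves room for \<open>a\<close>
  only if the norm is \<open>1\<close>.
\<close>

lemma lattice_small: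
  assumes xy: "(x, y) \<in> lattice" and x: "\<bar>x\<bar> < 1" and y: "\<bar>y\<bar> < \<beta>"
  shows "x = 0 \<and> y = 0 \<or> \<tau> = 1 \<and> (x = 1 - 1 / \<beta> \<and> y = 1 - \<beta> \<or> x = 1 / \<beta> - 1 \<and> y = \<beta> - 1)"
proof -
  obtain a b :: int where eq: "x = a + b * \<beta>" "y = a + b * \<beta>'" using xy by (rule latticeE)
  have big: "1 + \<beta> \<le> 2 * (\<beta> - \<beta>')"
    using sign
  proof
    assume "\<tau> = - 1 \<and> p \<ge> 1"
    then have "\<beta>' < 0" using conj_eq gt1 by auto
    moreover have "2 * (\<beta> - \<beta>') = \<beta> + \<beta> - 2 * \<beta>'" by simp
    ultimately show ?thesis using gt1 by linarith
  next
    assume s: "\<tau> = 1 \<and> p \<ge> 3"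
    then have "\<beta> > 2" using beta_bounds by force
    moreover have "\<beta>' = p - \<beta>" "\<beta>' = 1 / \<beta>" using conj_eq trace s by auto
    moreover have "1 / \<beta> < 1 / 2" using \<open>\<beta> > 2\<close> by (simp add: field_simps)
    ultimately have "\<beta>' < 1 / 2" by simp
    with \<open>\<beta> > 2\<close> show ?thesis by simp
  qed
  have "\<bar>b * (\<beta> - \<beta>')\<bar> < 1 + \<beta>" using x y eq by (auto simp: algebra_simps)
  then have "\<bar>b\<bar> * (\<beta> - \<beta>') < 2 * (\<beta> - \<beta>')" using big gt1 conj_less by (simp add: abs_mult)
  then have "\<bar>real_of_int b\<bar> < 2"
    using gt1 conj_less mult_less_cancel_right_pos[of "\<beta> - \<beta>'" "\<bar>real_of_int b\<bar>" 2] by simp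
  then have "\<bar>b\<bar> < 2" by linarith
  then consider "b = 0" | "b = 1" | "b = - 1" by linarith
  note b = this
  have key: "\<tau> = 1 \<and> k = p - 1" if k: "\<bar>\<beta> - k\<bar> < 1" "\<bar>\<beta>' - k\<bar> < \<beta>" for k :: int
    using sign
  proof
    assume s: "\<tau> = - 1 \<and> p \<ge> 1"
    then have "k \<ge> p" using beta_bounds k(1) by linarith
    then have "\<beta>' - k \<le> - \<beta>" using trace by linarith
    then show ?thesis using k gt1 by linarith
  next
    assume s: "\<tau> = 1 \<and> p \<ge> 3"
    have "k \<ge> p - 1" using beta_bounds k(1) s by linarith
    moreover have "k < p" using trace k(2) by linarith
    ultimately show ?thesis using s by linarith
  qed
  have val: "\<beta> - (p - 1) = 1 - 1 / \<beta>" "\<beta>' - (p - 1) = 1 - \<beta>" if "\<tau> = 1"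
    using that trace conj_eq by auto
  from b show ?thesis
  proof cases
    case 1
    then have "\<bar>real_of_int a\<bar> < 1" using x eq by simp
    then have "a = 0" by linarith
    then show ?thesis using 1 eq by simp
  next
    case 2
    have "\<tau> = 1 \<and> - a = p - 1"
      by (rule key) (use x y eq 2 in auto)
    moreover from this have "a = 1 - p" by simp
    ultimately show ?thesis using eq 2 val by simp
  next
    case 3
    have "\<tau> = 1 \<and> a = p - 1"
      by (rule key) (use x y eq 3 in auto)
    then show ?thesis using eq 3 val by simp
  qed
qed

text \<open>
  Both coordinates of a lattice point determine each other. Multiplication by powers of the unit
  shrinks one coordinate while the other one is zero, so that the point enters the box of the
  previous lemma.
\<close>

lemma lattice_fst_zero:
  assumes "(0, y) \<in> lattice"
  shows "y = 0"
proof -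
  obtain n where n: "\<bar>y\<bar> < \<beta> ^ n" using real_arch_pow gt1 by blast
  have "(0, \<beta>' ^ n * y) \<in> lattice"
  proof (induction n)
    case (Suc n)
    from lattice_mult[OF this] show ?case by (simp add: mult.assoc)
  qed (use assms in simp)
  moreover have "\<bar>\<beta>' ^ n * y\<bar> < 1"
    using n gt1 by (simp add: abs_mult power_abs abs_conj field_simps)
  ultimately have "\<beta>' ^ n * y = 0" using lattice_small[of 0 "\<beta>' ^ n * y"] gt1 by auto
  then show ?thesis using abs_conj gt1 by auto
qed

lemma lattice_snd_zero:
  assumes "(x, 0) \<in> lattice"
  shows "x = 0"
proof -
  obtain n where n: "\<bar>x\<bar> < \<beta> ^ n" using real_arch_pow gt1 by blast
  have "(x / \<beta> ^ n, 0) \<in> lattice"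
  proof (induction n)
    case (Suc n)
    from lattice_div[OF this] show ?case by (simp add: mult.commute)
  qed (use assms in simp)
  moreover have "\<bar>x / \<beta> ^ n\<bar> < 1"
    using n gt1 by (simp add: abs_mult field_simps)
  ultimately have "x / \<beta> ^ n = 0" using lattice_small[of "x / \<beta> ^ n" 0] gt1 by auto
  then show ?thesis using gt1 by auto
qed

lemma lattice_scaled_small:
  assumes xy: "(x, y) \<in> lattice" and "0 < x" "y \<noteq> 0" "\<epsilon> > 0"
  shows "\<exists>u v. (u, v) \<in> lattice \<and> 0 < u \<and> \<bar>v\<bar> < \<epsilon> \<and> sgn v = sgn y"
proof -
  obtain n where n: "\<bar>y\<bar> / \<epsilon> < (\<beta>\<^sup>2) ^ n" using real_arch_pow[of "\<beta>\<^sup>2"] gt1 by (auto simp: one_less_power)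
  have "((\<beta>\<^sup>2) ^ n * x, (\<beta>'\<^sup>2) ^ n * y) \<in> lattice"
  proof (induction n)
    case (Suc n)
    from lattice_mult[OF lattice_mult[OF this]] show ?case by (simp add: power2_eq_square mult.assoc)
  qed (use xy in simp)
  moreover have "\<bar>(\<beta>'\<^sup>2) ^ n * y\<bar> < \<epsilon>"
    using n gt1 \<open>\<epsilon> > 0\<close> abs_conj
    by (simp add: abs_mult power_abs flip: power2_abs[of \<beta>']) (simp add: field_simps)
  moreover have "\<beta>' \<noteq> 0" using abs_conj gt1 by auto
  moreover have "(\<beta>'\<^sup>2) ^ n > 0" using calculation(3) by simp
  then have "sgn ((\<beta>'\<^sup>2) ^ n * y) = sgn y" by (simp only: sgn_mult sgn_pos mult_1)
  moreover have "0 < (\<beta>\<^sup>2) ^ n * x" using gt1 \<open>0 < x\<close> by simp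
  ultimately show ?thesis by blast
qed

text \<open>
  Steps in both directions come from \<open>1\<close> and \<open>\<beta> - 1\<close>, whose conjugates have opposite signs;
  multiplied by a high power of \<open>\<beta>\<^sup>2\<close> they stay positive while their conjugates become small and
  keep their signs. The factor \<open>\<kappa>\<close> may be negative, which reflects the window.
\<close>

lemma planar_lattice_scaled:
  assumes \<kappa>: "\<kappa> \<noteq> 0"
  shows "planar_lattice ((\<lambda>(x, y). (x, \<kappa> * y)) ` lattice)" (is "planar_lattice ?L")
proof
  have mem: "(x, y) \<in> ?L \<longleftrightarrow> (x, y / \<kappa>) \<in> lattice" for x y
  proof
    assume "(x, y / \<kappa>) \<in> lattice"
    from imageI[OF this, of "\<lambda>(x, y). (x, \<kappa> * y)"] show "(x, y) \<in> ?L" using \<kappa> by simp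
  qed (use \<kappa> in auto)
  have small: "\<exists>u v. (u, v) \<in> ?L \<and> 0 < u \<and> \<bar>v\<bar> < 1 \<and> sgn v = sgn \<kappa> * sgn y"
    if xy: "(x, y) \<in> lattice" "0 < x" "y \<noteq> 0" for x y
  proof -
    obtain u v where uv: "(u, v) \<in> lattice" "0 < u" "\<bar>v\<bar> < 1 / \<bar>\<kappa>\<bar>" "sgn v = sgn y"
      using lattice_scaled_small[OF xy, of "1 / \<bar>\<kappa>\<bar>"] \<kappa> by auto
    have "(u, \<kappa> * v) \<in> ?L" using uv(1) \<kappa> by (simp add: mem)
    moreover have "\<bar>\<kappa> * v\<bar> < 1" using uv(3) \<kappa> by (simp add: abs_mult field_simps)
    ultimately show ?thesis using uv(2,4) by (metis sgn_mult)
  qed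
  have one: "(1, 1) \<in> lattice" using lattice_int[of 1] by simp
  have two: "(\<beta> - 1, \<beta>' - 1) \<in> lattice" using lattice_mem[of "-1" 1] by simp
  have s: "sgn (1::real) = 1" "sgn (\<beta>' - 1) = - 1" using conj_less by auto
  obtain u v where uv: "(u, v) \<in> ?L" "0 < u" "\<bar>v\<bar> < 1" "sgn v = sgn \<kappa>"
    using small[OF one] unfolding s by force
  obtain u' v' where uv': "(u', v') \<in> ?L" "0 < u'" "\<bar>v'\<bar> < 1" "sgn v' = - sgn \<kappa>"
    using small[OF two] gt1 conj_less unfolding s by force
  have "\<exists>x y. (x, y) \<in> ?L \<and> 0 < x \<and> 0 < y \<and> y < 1 \<and> (\<exists>x' y'. (x', y') \<in> ?L \<and> 0 < x' \<and> - 1 < y' \<and> y' < 0)"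
  proof (cases "\<kappa> > 0")
    case True
    then have "0 < v" "v' < 0" using uv(4) uv'(4) by (auto simp: sgn_1_pos sgn_1_neg)
    moreover have "v < 1" "- 1 < v'" using uv(3) uv'(3) by auto
    ultimately show ?thesis using uv(1,2) uv'(1,2) by blast
  next
    case False
    then have "v < 0" "0 < v'" using uv(4) uv'(4) \<kappa> by (auto simp: sgn_1_pos sgn_1_neg)
    moreover have "- 1 < v" "v' < 1" using uv(3) uv'(3) by auto
    ultimately show ?thesis using uv(1,2) uv'(1,2) by blast
  qed
  then show "\<exists>x y. (x, y) \<in> ?L \<and> 0 < x \<and> 0 < y \<and> y < 1"
    "\<exists>x y. (x, y) \<in> ?L \<and> 0 < x \<and> - 1 < y \<and> y < 0" by blast+
  show "(x - u, y - v) \<in> ?L" if "(x, y) \<in> ?L" "(u, v) \<in> ?L" for x y u v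
    using that lattice_diff unfolding mem by (simp add: diff_divide_distrib)
  show "y = 0" if "(0, y) \<in> ?L" for y
    using that \<kappa> lattice_fst_zero unfolding mem by force
  show "x = 0" if "(x, 0) \<in> ?L" for x
    using that lattice_snd_zero unfolding mem by force
  show "finite {z \<in> ?L. \<bar>fst z\<bar> \<le> c \<and> \<bar>snd z\<bar> \<le> 1}" for c
  proof (rule finite_subset)
    show "{z \<in> ?L. \<bar>fst z\<bar> \<le> c \<and> \<bar>snd z\<bar> \<le> 1} \<subseteq>
        (\<lambda>(x, y). (x, \<kappa> * y)) ` {z \<in> lattice. \<bar>fst z\<bar> \<le> c \<and> \<bar>snd z\<bar> \<le> 1 / \<bar>\<kappa>\<bar>}"
      using \<kappa> by (auto simp: abs_mult field_simps)
  qed (use finite_lattice_box in blast)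
qed

end

section \<open>Digit expansions and their conjugates\<close>

definition mid :: "int \<Rightarrow> int \<Rightarrow> real" where "mid m M = (of_int m + of_int M) / 2"
definition half_width :: "int \<Rightarrow> int \<Rightarrow> real" where "half_width m M = (of_int M - of_int m) / 2"

text \<open>
  A real number is within \<open>1 / 2\<close> of a digit unless it lies further out than that, in which case the
  outermost digit is the closest one.
\<close>

lemma nearest_digit:
  fixes m M :: int and v :: real
  assumes "m \<le> M"
  shows "\<exists>a\<in>{m..M}. \<bar>v - a\<bar> \<le> max (1 / 2) (\<bar>v - mid m M\<bar> - half_width m M)"
proof -
  consider "v < m" | "v > M" | "m \<le> v" "v \<le> M" by linarith
  then show ?thesis
  proof cases
    case 1
    then have "\<bar>v - m\<bar> = \<bar>v - mid m M\<bar> - half_width m M" using assms by (simp add: mid_def half_width_def field_simps)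
    then show ?thesis using assms by (intro bexI[of _ m]) auto
  next
    case 2
    then have "\<bar>v - M\<bar> = \<bar>v - mid m M\<bar> - half_width m M" using assms by (simp add: mid_def half_width_def field_simps)
    then show ?thesis using assms by (intro bexI[of _ M]) auto
  next
    case 3
    have "\<bar>v - round v\<bar> \<le> 1 / 2" using of_int_round_abs_le[of v] by (simp add: abs_minus_commute)
    moreover have "round v \<in> {m..M}"
      using round_mono[OF 3(1)] round_mono[OF 3(2)] by simp
    ultimately show ?thesis by (intro bexI[of _ "round v"] max.coboundedI1)
  qed
qed

text \<open>
  The base is \<open>\<alpha> = \<sigma>\<beta>\<close> with \<open>\<sigma> = \<plusminus>1\<close>, and \<open>\<gamma> = \<sigma>\<beta>'\<close> is its conjugate.
\<close>

locale signed_quadratic_unit = quadratic_unit +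
  fixes \<sigma> :: int
  assumes \<sigma>: "\<sigma> = 1 \<or> \<sigma> = - 1"
begin

definition \<alpha> :: real where "\<alpha> = \<sigma> * \<beta>"
definition \<gamma> :: real where "\<gamma> = \<sigma> * \<beta>'"

lemma abs_alpha: "\<bar>\<alpha>\<bar> = \<beta>" and abs_gamma: "\<bar>\<gamma>\<bar> = 1 / \<beta>"
  using \<sigma> gt1 by (auto simp: \<alpha>_def \<gamma>_def abs_conj)

lemma gamma_eq: "\<gamma> = \<sigma> * \<tau> / \<beta>"
  unfolding \<gamma>_def by (simp add: conj_eq)

lemma nonzero: "\<alpha> \<noteq> 0" "\<gamma> \<noteq> 0" "1 - \<alpha> \<noteq> 0" "1 - \<gamma> \<noteq> 0"
  using abs_alpha abs_gamma gt1 by auto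

lemma lattice_step:
  assumes "(x, y) \<in> lattice"
  shows "(\<alpha> * x + of_int a, \<gamma> * y + of_int a) \<in> lattice"
proof (rule lattice_add)
  show "(\<alpha> * x, \<gamma> * y) \<in> lattice"
    using \<sigma> lattice_mult[OF assms] lattice_uminus[OF lattice_mult[OF assms]]
    by (auto simp: \<alpha>_def \<gamma>_def)
qed (simp add: lattice_int)

lemma lattice_back:
  assumes "(x, y) \<in> lattice"
  shows "((x - of_int a) / \<alpha>, (y - of_int a) / \<gamma>) \<in> lattice"
proof -
  have "((x - of_int a) / \<beta>, (y - of_int a) / \<beta>') \<in> lattice"
    by (intro lattice_div lattice_diff assms lattice_int) simp
  from \<sigma> this lattice_uminus[OF this] show ?thesis
    by (auto simp: \<alpha>_def \<gamma>_def)
qed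

text \<open>
  The spectrum together with the conjugates of its points, generated by Horner's scheme.
\<close>

inductive_set digit_pairs :: "int set \<Rightarrow> (real \<times> real) set" for D where
  zero: "(0, 0) \<in> digit_pairs D"
| step: "(x, y) \<in> digit_pairs D \<Longrightarrow> a \<in> D \<Longrightarrow> (\<alpha> * x + of_int a, \<gamma> * y + of_int a) \<in> digit_pairs D"

lemma digit_pairs_back:
  assumes "((x - of_int a) / \<alpha>, (y - of_int a) / \<gamma>) \<in> digit_pairs D" "a \<in> D"
  shows "(x, y) \<in> digit_pairs D"
  using digit_pairs.step[OF assms] nonzero by simp

lemma digit_pairs_mono: "(x, y) \<in> digit_pairs D \<Longrightarrow> D \<subseteq> D' \<Longrightarrow> (x, y) \<in> digit_pairs D'"
  by (induction rule: digit_pairs.induct) (auto intro: digit_pairs.intros)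

lemma digit_pairs_digit: "a \<in> D \<Longrightarrow> (of_int a, of_int a) \<in> digit_pairs D"
  using digit_pairs.step[OF digit_pairs.zero] by fastforce

lemma digit_pairs_lattice: "(x, y) \<in> digit_pairs D \<Longrightarrow> (x, y) \<in> lattice"
proof (induction rule: digit_pairs.induct)
  case zero
  show ?case using lattice_int[of 0] by simp
qed (rule lattice_step)

lemma digit_spectrum_eq:
  assumes "0 \<in> D"
  shows "digit_spectrum D \<alpha> = {x. \<exists>y. (x, y) \<in> digit_pairs D}"
proof
  have horner: "(\<Sum>j=0..Suc n. of_int (a j) * \<alpha> ^ j) = \<alpha> * (\<Sum>j=0..n. of_int (a (Suc j)) * \<alpha> ^ j) + of_int (a 0)"
    for n and a :: "nat \<Rightarrow> int"
    by (subst sum.atLeast0_atMost_Suc_shift) (simp add: sum_distrib_left algebra_simps)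
  show "digit_spectrum D \<alpha> \<subseteq> {x. \<exists>y. (x, y) \<in> digit_pairs D}"
  proof
    fix x assume "x \<in> digit_spectrum D \<alpha>"
    then obtain n a where x: "x = (\<Sum>j=0..n. of_int (a j) * \<alpha> ^ j)" and a: "\<forall>j\<le>n. a j \<in> D"
      unfolding digit_spectrum_def by blast
    have "\<exists>y. ((\<Sum>j=0..n. of_int (a j) * \<alpha> ^ j), y) \<in> digit_pairs D"
      using a
    proof (induction n arbitrary: a)
      case 0
      then show ?case using digit_pairs_digit by auto
    next
      case (Suc n)
      have "\<forall>j\<le>n. a (Suc j) \<in> D" using Suc.prems by simp
      from Suc.IH[OF this] obtain y where "((\<Sum>j=0..n. of_int (a (Suc j)) * \<alpha> ^ j), y) \<in> digit_pairs D" by blast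
      then show ?case unfolding horner using digit_pairs.step Suc.prems by blast
    qed
    then show "x \<in> {x. \<exists>y. (x, y) \<in> digit_pairs D}" using x by simp
  qed
  show "{x. \<exists>y. (x, y) \<in> digit_pairs D} \<subseteq> digit_spectrum D \<alpha>"
  proof clarify
    fix x y assume "(x, y) \<in> digit_pairs D"
    then show "x \<in> digit_spectrum D \<alpha>"
    proof induction
      case zero
      show ?case unfolding digit_spectrum_def
        using assms by (auto intro!: exI[of _ 0] exI[of _ "\<lambda>_. 0"])
    next
      case (step x y a)
      then obtain n b where x: "x = (\<Sum>j=0..n. of_int (b j) * \<alpha> ^ j)" and b: "\<forall>j\<le>n. b j \<in> D"
        unfolding digit_spectrum_def by blast
      define b' where "b' = case_nat a b"
      have "\<alpha> * x + of_int a = (\<Sum>j=0..Suc n. of_int (b' j) * \<alpha> ^ j)"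
        unfolding horner by (simp add: b'_def x)
      moreover have "\<forall>j\<le>Suc n. b' j \<in> D" using b step by (auto simp: b'_def split: nat.split)
      ultimately show ?case unfolding digit_spectrum_def by blast
    qed
  qed
qed

section \<open>Expanding the lattice points over the window\<close>

text \<open>
  The conjugates \<open>\<Sum> a\<^sub>j \<gamma>\<^sup>j\<close> fill the interval of the given centre and radius: it is the fixed point
  of \<open>\<Omega> \<mapsto> \<Union>a. \<gamma>\<Omega> + a\<close>. The dual interval is the attractor of the maps \<open>x \<mapsto> (x - a) / \<alpha>\<close> that strip
  the last digit. Describing the intervals by centres makes the formulas the same for both signs of
  \<open>\<alpha>\<close> and \<open>\<gamma>\<close>.
\<close>

definition centre :: "int \<Rightarrow> int \<Rightarrow> real" where "centre m M = mid m M / (1 - \<gamma>)"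
definition radius :: "int \<Rightarrow> int \<Rightarrow> real" where "radius m M = half_width m M * \<beta> / (\<beta> - 1)"
definition dual_centre :: "int \<Rightarrow> int \<Rightarrow> real" where "dual_centre m M = mid m M / (1 - \<alpha>)"
definition dual_radius :: "int \<Rightarrow> int \<Rightarrow> real" where "dual_radius m M = half_width m M / (\<beta> - 1)"

text \<open>
  Every lattice point over the open window is reached by Horner's scheme, that is, the spectrum
  contains the whole cut-and-project set of the window.
\<close>

definition fills :: "int \<Rightarrow> int \<Rightarrow> bool" where
  "fills m M \<longleftrightarrow> (\<forall>x y. (x, y) \<in> lattice \<longrightarrow> \<bar>y - centre m M\<bar> < radius m M \<longrightarrow> (x, y) \<in> digit_pairs {m..M})"

lemma centre_fixed: "centre m M - \<gamma> * centre m M = mid m M"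
proof -
  have "centre m M - \<gamma> * centre m M = (1 - \<gamma>) * centre m M" by (simp add: algebra_simps)
  also have "\<dots> = mid m M"
    using nonzero(4) by (simp add: centre_def)
  finally show ?thesis .
qed

lemma dual_centre_fixed: "dual_centre m M - \<alpha> * dual_centre m M = mid m M"
proof -
  have "dual_centre m M - \<alpha> * dual_centre m M = (1 - \<alpha>) * dual_centre m M" by (simp add: algebra_simps)
  also have "\<dots> = mid m M"
    using nonzero(3) by (simp add: dual_centre_def)
  finally show ?thesis .
qed

lemma radius_fixed: "radius m M / \<beta> + half_width m M = radius m M"
  using gt1 by (simp add: radius_def field_simps)

lemma radius_eq: "radius m M = \<beta> * dual_radius m M"
  by (simp add: radius_def dual_radius_def)

lemma radius_wide:
  assumes "real_of_int (M - m) > \<beta> - 1"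
  shows "1 / 2 < radius m M / \<beta>"
proof -
  have "radius m M / \<beta> = half_width m M / (\<beta> - 1)" using gt1 by (simp add: radius_def)
  moreover have "1 / 2 * (\<beta> - 1) < half_width m M" using assms by (simp add: half_width_def)
  ultimately show ?thesis using gt1 by (simp add: pos_less_divide_eq)
qed

lemma back_dist: "\<bar>(y - of_int a) / \<gamma> - c\<bar> = \<beta> * \<bar>y - \<gamma> * c - of_int a\<bar>"
proof -
  have "(y - of_int a) / \<gamma> - c = (y - \<gamma> * c - of_int a) / \<gamma>"
    using nonzero by (simp add: field_simps)
  then show ?thesis using gt1 by (simp add: abs_gamma)
qed

lemma back_dist_dual: "\<bar>(x - of_int a) / \<alpha> - c\<bar> = \<bar>x - \<alpha> * c - of_int a\<bar> / \<beta>"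
proof -
  have "(x - of_int a) / \<alpha> - c = (x - \<alpha> * c - of_int a) / \<alpha>"
    using nonzero by (simp add: field_simps)
  then show ?thesis using gt1 by (simp add: abs_alpha)
qed

text \<open>
  The intervals \<open>\<gamma>\<Omega> + a\<close> have length more than \<open>1\<close>, because there are more than \<open>\<beta>\<close> digits, and
  hence cover \<open>\<Omega>\<close>.
\<close>

lemma ex_digit_in_window:
  assumes "m \<le> M" and wide: "real_of_int (M - m) > \<beta> - 1" and y: "\<bar>y - centre m M\<bar> < radius m M"
  shows "\<exists>a\<in>{m..M}. \<bar>(y - of_int a) / \<gamma> - centre m M\<bar> < radius m M"
proof -
  define v where "v = y - \<gamma> * centre m M"
  have v: "v - mid m M = y - centre m M" using centre_fixed[of m M] unfolding v_def by linarith
  obtain a where a: "a \<in> {m..M}" and near: "\<bar>v - a\<bar> \<le> max (1 / 2) (\<bar>v - mid m M\<bar> - half_width m M)"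
    using nearest_digit[OF assms(1)] by blast
  have "1 / 2 < radius m M / \<beta>" using wide by (rule radius_wide)
  moreover have "\<bar>v - mid m M\<bar> - half_width m M < radius m M / \<beta>"
    using y radius_fixed[of m M] unfolding v by linarith
  ultimately have "\<bar>v - a\<bar> < radius m M / \<beta>" using near by linarith
  then have "\<beta> * \<bar>v - a\<bar> < radius m M" using gt1 by (simp add: field_simps)
  then show ?thesis using a unfolding back_dist v_def by blast
qed

lemma dual_contraction:
  assumes "a \<in> {m..M}"
  shows "\<bar>(x - of_int a) / \<alpha> - dual_centre m M\<bar> \<le> (\<bar>x - dual_centre m M\<bar> + half_width m M) / \<beta>"
proof -
  have "\<bar>a - mid m M\<bar> \<le> half_width m M"
    using assms by (auto simp: mid_def half_width_def abs_le_iff add_divide_distrib diff_divide_distrib)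
  then have "\<bar>x - \<alpha> * dual_centre m M - a\<bar> \<le> \<bar>x - dual_centre m M\<bar> + half_width m M"
    using dual_centre_fixed[of m M] by linarith
  then show ?thesis using gt1 unfolding back_dist_dual by (simp add: divide_right_mono)
qed

text \<open>
  Stripping digits keeps a lattice point over the window, by the previous lemma and because
  \<open>\<alpha>\<close> is a unit, while its first coordinate strictly approaches the dual centre as long as it is
  outside the dual interval. Only finitely many lattice points are at least as close, so the dual
  interval is reached after finitely many steps.
\<close>

lemma fills_if_residual:
  assumes "m \<le> M" and wide: "real_of_int (M - m) > \<beta> - 1"
    and res: "\<And>x y. (x, y) \<in> lattice \<Longrightarrow> \<bar>y - centre m M\<bar> < radius m M \<Longrightarrow>
      \<bar>x - dual_centre m M\<bar> \<le> dual_radius m M \<Longrightarrow> (x, y) \<in> digit_pairs {m..M}"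
  shows "fills m M"
proof -
  define S where "S x = {z \<in> lattice. \<bar>snd z - centre m M\<bar> < radius m M \<and>
      \<bar>fst z - dual_centre m M\<bar> < \<bar>x - dual_centre m M\<bar>}" for x
  have fin: "finite (S x)" for x
    by (rule finite_subset[OF _ finite_lattice_box[of "\<bar>x - dual_centre m M\<bar> + \<bar>dual_centre m M\<bar>"
      "radius m M + \<bar>centre m M\<bar>"]]) (auto simp: S_def)
  have "(x, y) \<in> lattice \<Longrightarrow> \<bar>y - centre m M\<bar> < radius m M \<Longrightarrow> (x, y) \<in> digit_pairs {m..M}" for x y
  proof (induction "card (S x)" arbitrary: x y rule: less_induct)
    case less
    show ?case
    proof (cases "\<bar>x - dual_centre m M\<bar> \<le> dual_radius m M")
      case True
      then show ?thesis using less.prems res by blast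
    next
      case False
      obtain a where a: "a \<in> {m..M}" and win: "\<bar>(y - of_int a) / \<gamma> - centre m M\<bar> < radius m M"
        using ex_digit_in_window[OF assms(1,2) less.prems(2)] by blast
      define x1 where "x1 = (x - of_int a) / \<alpha>"
      have "\<bar>x1 - dual_centre m M\<bar> * \<beta> \<le> \<bar>x - dual_centre m M\<bar> + half_width m M"
        using dual_contraction[OF a, of x] gt1 by (simp add: x1_def field_simps)
      moreover have "half_width m M = (\<beta> - 1) * dual_radius m M"
        using gt1 by (simp add: dual_radius_def)
      moreover have "\<dots> < (\<beta> - 1) * \<bar>x - dual_centre m M\<bar>" using False gt1 by simp
      ultimately have "\<bar>x1 - dual_centre m M\<bar> * \<beta> < \<bar>x - dual_centre m M\<bar> * \<beta>" by (simp add: algebra_simps)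
      then have closer: "\<bar>x1 - dual_centre m M\<bar> < \<bar>x - dual_centre m M\<bar>" using gt1 by simp
      have mem: "(x1, (y - of_int a) / \<gamma>) \<in> lattice"
        using lattice_back[OF less.prems(1)] by (simp add: x1_def)
      have "S x1 \<subseteq> S x" using closer by (auto simp: S_def)
      moreover have "(x1, (y - of_int a) / \<gamma>) \<in> S x" "(x1, (y - of_int a) / \<gamma>) \<notin> S x1"
        using closer mem win by (simp_all add: S_def)
      ultimately have "S x1 \<subset> S x" by blast
      then have "card (S x1) < card (S x)" by (rule psubset_card_mono[OF fin])
      from less.hyps[OF this mem win] show ?thesis unfolding x1_def by (rule digit_pairs_back) (rule a)
    qed
  qed
  then show ?thesis by (auto simp: fills_def)
qed

lemma square_ge: "\<beta>\<^sup>2 \<ge> \<beta> + 1"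
proof -
  have "real_of_int p * \<beta> - \<tau> \<ge> \<beta> + 1"
    using sign
  proof
    assume "\<tau> = - 1 \<and> p \<ge> 1"
    then have "1 * \<beta> \<le> p * \<beta>" using gt1 by (intro mult_right_mono) auto
    then show ?thesis using \<open>\<tau> = - 1 \<and> p \<ge> 1\<close> by simp
  next
    assume "\<tau> = 1 \<and> p \<ge> 3"
    then have "3 * \<beta> \<le> p * \<beta>" using gt1 by (intro mult_right_mono) auto
    moreover have "real_of_int \<tau> = 1" using \<open>\<tau> = 1 \<and> p \<ge> 3\<close> by simp
    ultimately show ?thesis using gt1 by linarith
  qed
  then show ?thesis using square by simp
qed

lemma beta_gt_three_halves: "\<beta> > 3 / 2"
proof (rule ccontr)
  assume "\<not> \<beta> > 3 / 2"
  then have "\<beta> * \<beta> \<le> 3 / 2 * \<beta>" using gt1 by (intro mult_right_mono) auto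
  then show False using square_ge \<open>\<not> \<beta> > 3 / 2\<close> by (simp add: power2_eq_square)
qed

text \<open>
  For larger digit sets the dual interval contains many lattice points, and they are not examined.
  Instead one digit is removed at an end. Stripping digits is expanding in the second coordinate, so
  a point over the window of the larger digit set can be driven into the window of the smaller one:
  \<open>inner\<close> does so in one step away from the ends of the window, and \<open>outer\<close> moves a point near an
  end inwards, as stripping the outermost digit multiplies its distance to the nearer end by \<open>\<beta>\<close>.
\<close>

lemma fills_enlarge:
  assumes le: "m \<le> m1" "m1 \<le> M1" "M1 \<le> M" and one: "M1 - m1 = M - m - 1"
    and wide: "real_of_int (M - m) > \<beta>" and fills1: "fills m1 M1"
  shows "fills m M"
proof -
  define e where "e = 1 / (2 * (\<beta> - 1))"
  (* The bound e accounts for the displacement of the two windows against each other. Up to distance K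
     from the centre there is a digit whose removal leads to within beta / 2 of the centre of the smaller
     window, hence inside it. *)
  define K where "K = half_width m M + 1 / 2 - e"
  have s2: "M - m \<ge> 2" using wide gt1 by linarith
  have shift: "\<bar>\<gamma> * (centre m M - centre m1 M1)\<bar> \<le> e"
  proof -
    have "m1 = m \<and> M1 = M - 1 \<or> m1 = m + 1 \<and> M1 = M" using le one by linarith
    then have "\<bar>mid m M - mid m1 M1\<bar> = 1 / 2" by (auto simp: mid_def field_simps)
    moreover have "centre m M - centre m1 M1 = (mid m M - mid m1 M1) / (1 - \<gamma>)"
      by (simp add: centre_def diff_divide_distrib)
    ultimately have "\<bar>\<gamma> * (centre m M - centre m1 M1)\<bar> = 1 / \<beta> * (1 / 2 / \<bar>1 - \<gamma>\<bar>)"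
      by (simp only: abs_mult abs_gamma abs_divide)
    also have "\<dots> \<le> 1 / \<beta> * (1 / 2 / (1 - 1 / \<beta>))"
      using gt1 abs_gamma by (intro mult_left_mono divide_left_mono mult_pos_pos) auto
    also have "\<dots> = e" using gt1 by (simp add: e_def field_simps)
    finally show ?thesis .
  qed
  have inner: "(x, y) \<in> digit_pairs {m..M}" if xy: "(x, y) \<in> lattice" and Y: "\<bar>y - centre m M\<bar> \<le> K" for x y
  proof -
    define v where "v = y - \<gamma> * centre m1 M1"
    have "v - mid m M = y - centre m M + \<gamma> * (centre m M - centre m1 M1)"
      using centre_fixed[of m M] by (simp add: v_def algebra_simps)
    then have "\<bar>v - mid m M\<bar> \<le> K + e" using Y shift by linarith
    then have "\<bar>v - mid m M\<bar> - half_width m M \<le> 1 / 2" by (simp add: K_def)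
    then obtain a where a: "a \<in> {m..M}" "\<bar>v - a\<bar> \<le> 1 / 2"
      using nearest_digit[of m M v] le by force
    have "1 / 2 < radius m1 M1 / \<beta>" using wide one by (intro radius_wide) simp
    then have "\<bar>v - a\<bar> < radius m1 M1 / \<beta>" using a(2) by linarith
    then have "\<beta> * \<bar>v - a\<bar> < radius m1 M1" using gt1 by (simp add: field_simps)
    then have "\<bar>(y - of_int a) / \<gamma> - centre m1 M1\<bar> < radius m1 M1" unfolding back_dist v_def .
    then have "((x - of_int a) / \<alpha>, (y - of_int a) / \<gamma>) \<in> digit_pairs {m1..M1}"
      using fills1 lattice_back[OF xy, of a] by (simp add: fills_def)
    then have "((x - of_int a) / \<alpha>, (y - of_int a) / \<gamma>) \<in> digit_pairs {m..M}"
      by (rule digit_pairs_mono) (use le in auto)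
    then show ?thesis using a(1) by (rule digit_pairs_back)
  qed
  have K: "\<beta> * (e - 1 / 2) \<le> K"
  proof -
    have "\<beta> + 1 \<le> (\<beta> + 3) * (\<beta> - 1)"
      using square_ge beta_gt_three_halves by (simp add: algebra_simps power2_eq_square)
    then have "(\<beta> + 1) * e \<le> (\<beta> + 3) / 2" using gt1 by (simp add: e_def field_simps)
    then have "\<beta> * (e - 1 / 2) \<le> 3 / 2 - e" by (simp add: field_simps)
    also have "\<dots> \<le> K" using s2 by (simp add: K_def half_width_def)
    finally show ?thesis .
  qed
  (* The exponent n bounds the number of digits stripped before the point is within K. *)
  have outer: "(x, y) \<in> digit_pairs {m..M}"
    if "(x, y) \<in> lattice" "\<bar>y - centre m M\<bar> < radius m M"
      "radius m M - K \<le> \<beta> ^ n * (radius m M - \<bar>y - centre m M\<bar>)" for n x y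
    using that
  proof (induction n arbitrary: x y)
    case 0
    then show ?case using inner by simp
  next
    case (Suc n)
    define Y where "Y = y - centre m M"
    show ?case
    proof (cases "\<bar>Y\<bar> \<le> K")
      case True
      then show ?thesis using inner Suc.prems by (simp add: Y_def)
    next
      case False
      define a where "a = (if Y \<ge> 0 then M else m)"
      have a: "a \<in> {m..M}" using le by (auto simp: a_def)
      define Y1 where "Y1 = (y - of_int a) / \<gamma> - centre m M"
      have "y - \<gamma> * centre m M - a = Y - (a - mid m M)"
        using centre_fixed[of m M] unfolding Y_def by linarith
      then have "\<bar>Y1\<bar> = \<beta> * \<bar>Y - (a - mid m M)\<bar>"
        unfolding Y1_def back_dist by (simp only:)
      also have "\<bar>Y - (a - mid m M)\<bar> = \<bar>\<bar>Y\<bar> - half_width m M\<bar>"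
        by (auto simp: a_def mid_def half_width_def field_simps)
      finally have Y1: "\<bar>Y1\<bar> = \<beta> * \<bar>\<bar>Y\<bar> - half_width m M\<bar>" .
      have rad: "radius m M = \<beta> * (radius m M - half_width m M)"
        using radius_fixed[of m M] gt1 by (simp add: field_simps)
      have less: "\<bar>Y\<bar> < radius m M" using Suc.prems by (simp add: Y_def)
      have pow: "1 \<le> \<beta> ^ n" using gt1 by simp
      have "\<bar>Y1\<bar> < radius m M \<and> radius m M - K \<le> \<beta> ^ n * (radius m M - \<bar>Y1\<bar>)"
      (* Below half_width the point overshoots the centre, but by so little that it lands within K. *)
      proof (cases "\<bar>Y\<bar> \<ge> half_width m M")
        case True
        then have "radius m M - \<bar>Y1\<bar> = \<beta> * (radius m M - \<bar>Y\<bar>)"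
          using Y1 rad by (simp add: algebra_simps)
        moreover have "0 < \<beta> * (radius m M - \<bar>Y\<bar>)" using less gt1 by simp
        ultimately show ?thesis using Suc.prems(3) by (simp add: Y_def mult.assoc mult.left_commute)
      next
        case short: False
        then have "\<bar>Y1\<bar> = \<beta> * (half_width m M - \<bar>Y\<bar>)" using Y1 by simp
        also have "\<dots> \<le> \<beta> * (e - 1 / 2)" using False gt1 by (simp add: K_def)
        also have "\<dots> \<le> K" by (rule K)
        finally have "\<bar>Y1\<bar> \<le> K" .
        moreover have "K < radius m M" using False less by simp
        moreover from calculation have "1 * (radius m M - K) \<le> \<beta> ^ n * (radius m M - \<bar>Y1\<bar>)"
          using pow by (intro mult_mono) auto
        ultimately show ?thesis by simp
      qed
      then show ?thesis
        using digit_pairs_back[OF Suc.IH[OF lattice_back[OF Suc.prems(1)], of a] a] unfolding Y1_def by simp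
    qed
  qed
  show ?thesis unfolding fills_def
  proof clarify
    fix x y assume xy: "(x, y) \<in> lattice" "\<bar>y - centre m M\<bar> < radius m M"
    obtain n where "(radius m M - K) / (radius m M - \<bar>y - centre m M\<bar>) < \<beta> ^ n"
      using real_arch_pow gt1 by blast
    then have "radius m M - K \<le> \<beta> ^ n * (radius m M - \<bar>y - centre m M\<bar>)"
      using xy by (simp add: field_simps)
    then show "(x, y) \<in> digit_pairs {m..M}" using outer xy by blast
  qed
qed


section \<open>Minimal digit sets\<close>

definition admissible :: "int \<Rightarrow> int \<Rightarrow> bool" where
  "admissible m M \<longleftrightarrow> m \<le> 0 \<and> 0 \<le> M \<and> (\<sigma> = 1 \<longrightarrow> m \<le> - 1 \<and> 1 \<le> M) \<and> real_of_int (M - m) > \<beta> - 1"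

text \<open>
  In most cases the window and the dual interval lie in the box of \<open>lattice_small\<close>, so that \<open>0\<close> is
  the only lattice point left to be examined.
\<close>

lemma small_points_in_digit_pairs:
  assumes xy: "(x, y) \<in> lattice" "\<bar>y - centre m M\<bar> < radius m M" "\<bar>x - dual_centre m M\<bar> \<le> dual_radius m M"
    and b1: "\<bar>dual_centre m M\<bar> + dual_radius m M < 1" and b2: "\<bar>centre m M\<bar> + radius m M \<le> \<beta>"
    and exc: "\<tau> = 1 \<Longrightarrow> \<not> (x = 1 - 1 / \<beta> \<and> y = 1 - \<beta>) \<and> \<not> (x = 1 / \<beta> - 1 \<and> y = \<beta> - 1)"
  shows "(x, y) \<in> digit_pairs D"
proof -
  have "\<bar>x\<bar> < 1" "\<bar>y\<bar> < \<beta>" using xy b1 b2 by linarith+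
  then have "x = 0 \<and> y = 0" using lattice_small[OF xy(1)] exc by blast
  then show ?thesis using digit_pairs.zero by simp
qed

lemma sum_fractions_less:
  assumes "a * (\<beta> - 1) + b * (\<beta> + 1) < \<beta>\<^sup>2 - 1"
  shows "a / (\<beta> + 1) + b / (\<beta> - 1) < 1"
proof -
  have "a / (\<beta> + 1) + b / (\<beta> - 1) = (a * (\<beta> - 1) + b * (\<beta> + 1)) / ((\<beta> + 1) * (\<beta> - 1))"
    using gt1 by (simp add: add_frac_eq)
  also have "(\<beta> + 1) * (\<beta> - 1) = \<beta>\<^sup>2 - 1" by (simp add: algebra_simps power2_eq_square)
  also have "(a * (\<beta> - 1) + b * (\<beta> + 1)) / (\<beta>\<^sup>2 - 1) < 1"
    using assms gt1 by (simp add: one_less_power)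
  finally show ?thesis .
qed

lemma centre_signs:
  "\<sigma> * \<tau> = 1 \<Longrightarrow> centre m M = \<beta> * (mid m M / (\<beta> - 1))"
  "\<sigma> * \<tau> = - 1 \<Longrightarrow> centre m M = \<beta> * (mid m M / (\<beta> + 1))"
proof -
  show "centre m M = \<beta> * (mid m M / (\<beta> - 1))" if "\<sigma> * \<tau> = 1"
  proof -
    have "1 - \<gamma> = (\<beta> - 1) / \<beta>"
      unfolding gamma_eq of_int_mult[symmetric] that using gt1 by (simp add: field_simps)
    then show ?thesis by (simp add: centre_def)
  qed
  show "centre m M = \<beta> * (mid m M / (\<beta> + 1))" if "\<sigma> * \<tau> = - 1"
  proof -
    have "1 - \<gamma> = (\<beta> + 1) / \<beta>"
      unfolding gamma_eq of_int_mult[symmetric] that using gt1 by (simp add: field_simps)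
    then show ?thesis by (simp add: centre_def)
  qed
qed

lemma dual_centre_signs:
  "\<sigma> = 1 \<Longrightarrow> dual_centre m M = - (mid m M / (\<beta> - 1))"
  "\<sigma> = - 1 \<Longrightarrow> dual_centre m M = mid m M / (\<beta> + 1)"
proof -
  show "dual_centre m M = - (mid m M / (\<beta> - 1))" if "\<sigma> = 1"
  proof -
    have "1 - \<alpha> = - (\<beta> - 1)" unfolding \<alpha>_def unfolding that by simp
    then show ?thesis unfolding dual_centre_def by (simp only: divide_minus_right)
  qed
  show "dual_centre m M = mid m M / (\<beta> + 1)" if "\<sigma> = - 1"
  proof -
    have "1 - \<alpha> = \<beta> + 1" unfolding \<alpha>_def unfolding that by simp
    then show ?thesis unfolding dual_centre_def by (simp only:)
  qed
qed

text \<open>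
  The case of norm \<open>-1\<close> and \<open>p + 1\<close> digits, the least possible number, with \<open>0\<close> strictly between
  the extreme digits. The two signs of \<open>\<alpha>\<close> exchange the roles of the denominators \<open>\<beta> - 1\<close> and
  \<open>\<beta> + 1\<close> in the centres of the window and of the dual interval.
\<close>

lemma fills_minimal_norm_neg_inner:
  assumes \<tau>: "\<tau> = - 1" and w: "M - m = p" and mM: "m < 0" "0 < M"
  shows "fills m M"
proof (rule fills_if_residual)
  show "m \<le> M" "real_of_int (M - m) > \<beta> - 1" using mM w beta_bounds(1)[OF \<tau>] by auto
  fix x y assume xy: "(x, y) \<in> lattice" "\<bar>y - centre m M\<bar> < radius m M" "\<bar>x - dual_centre m M\<bar> \<le> dual_radius m M"
  have h: "half_width m M = p / 2" by (simp add: half_width_def flip: w)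
  have mid: "\<bar>mid m M\<bar> \<le> p / 2 - 1"
    using mM by (auto simp: mid_def abs_le_iff field_simps simp flip: w)
  have "(p / 2 - 1) * (\<beta> - 1) + p / 2 * (\<beta> + 1) < \<beta>\<^sup>2 - 1"
  proof -
    have "(p / 2 - 1) * (\<beta> - 1) + p / 2 * (\<beta> + 1) = p * \<beta> - \<beta> + 1" by (simp add: field_simps)
    then show ?thesis using gt1 \<tau> unfolding square by simp
  qed
  then have s1: "(p / 2 - 1) / (\<beta> + 1) + (p / 2) / (\<beta> - 1) < 1" by (rule sum_fractions_less)
  have "\<bar>mid m M\<bar> / (\<beta> + 1) \<le> (p / 2 - 1) / (\<beta> + 1)" using mid gt1 by (intro divide_right_mono) auto
  then have plus: "\<bar>mid m M / (\<beta> + 1)\<bar> + dual_radius m M < 1"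
    using s1 gt1 by (simp add: dual_radius_def h)
  have "\<bar>mid m M\<bar> / (\<beta> - 1) + dual_radius m M = (\<bar>mid m M\<bar> + p / 2) / (\<beta> - 1)"
    by (simp only: dual_radius_def h add_divide_distrib)
  also have "\<dots> \<le> (p - 1) / (\<beta> - 1)" using mid gt1 by (intro divide_right_mono) auto
  also have "\<dots> < 1" using beta_bounds(1)[OF \<tau>] gt1 by simp
  finally have minus: "\<bar>mid m M / (\<beta> - 1)\<bar> + dual_radius m M < 1"
    using gt1 by simp
  have scale: "\<beta> * u \<le> \<beta>" if "u < 1" for u using that gt1 by simp
  from \<sigma> show "(x, y) \<in> digit_pairs {m..M}"
  proof
    assume s: "\<sigma> = 1"
    then have "\<sigma> * \<tau> = - 1" using \<tau> by simp
    note cs = dual_centre_signs(1)[OF s] centre_signs(2)[OF this]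
    show ?thesis
    proof (rule small_points_in_digit_pairs[OF xy])
      show "\<bar>dual_centre m M\<bar> + dual_radius m M < 1" using minus by (simp only: cs abs_minus)
      show "\<bar>centre m M\<bar> + radius m M \<le> \<beta>"
        using scale[OF plus] gt1 by (simp add: cs radius_eq abs_mult distrib_left)
    qed (use \<tau> in simp)
  next
    assume s: "\<sigma> = - 1"
    then have "\<sigma> * \<tau> = 1" using \<tau> by simp
    note cs = dual_centre_signs(2)[OF s] centre_signs(1)[OF this]
    show ?thesis
    proof (rule small_points_in_digit_pairs[OF xy])
      show "\<bar>dual_centre m M\<bar> + dual_radius m M < 1" using plus by (simp only: cs)
      show "\<bar>centre m M\<bar> + radius m M \<le> \<beta>"
        using scale[OF minus] gt1 by (simp add: cs radius_eq abs_mult distrib_left)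
    qed (use \<tau> in simp)
  qed
qed

text \<open>
  If \<open>0\<close> is an extreme digit, then the dual interval has ends \<open>1\<close> and \<open>-1 / \<beta>\<close>, up to the sign
  \<open>\<eta>\<close>. These ends, \<open>1\<close> and \<open>p - \<beta> = \<alpha> + p\<close>, are the only lattice points left,
  and their expansions are evident.
\<close>

lemma fills_minimal_norm_neg_extreme:
  assumes \<tau>: "\<tau> = - 1" and s: "\<sigma> = - 1" and mM: "m = 0 \<and> M = p \<or> m = - p \<and> M = 0"
  shows "fills m M"
proof (rule fills_if_residual)
  have "\<sigma> * \<tau> = 1" by (simp add: s \<tau>)
  note cs = dual_centre_signs(2)[OF s] centre_signs(1)[OF this]
  have p: "p \<ge> 1" using sign \<tau> by simp
  have pb: "real_of_int p = \<beta> - 1 / \<beta>" using trace conj_eq \<tau> by simp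
  show "m \<le> M" "real_of_int (M - m) > \<beta> - 1" using mM p beta_bounds(1)[OF \<tau>] by auto
  fix x y assume xy: "(x, y) \<in> lattice" "\<bar>y - centre m M\<bar> < radius m M" "\<bar>x - dual_centre m M\<bar> \<le> dual_radius m M"
  (* The reflection of all digits in 0 exchanges the two cases; eta reduces to digits 0, ..., p. *)
  define \<eta> :: int where "\<eta> = (if M = p then 1 else - 1)"
  have \<eta>: "\<eta> = 1 \<or> \<eta> = - 1" by (simp add: \<eta>_def)
  have mid: "mid m M = \<eta> * (p / 2)" and h: "half_width m M = p / 2"
    using mM p by (auto simp: mid_def half_width_def \<eta>_def)
  have pp: "p * \<beta> = (\<beta> + 1) * (\<beta> - 1)"
    using square \<tau> by (simp add: algebra_simps power2_eq_square)
  have rad: "radius m M = (\<beta> + 1) / 2"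
  proof -
    have "p / 2 * \<beta> = (\<beta> + 1) / 2 * (\<beta> - 1)" using pp by simp
    then have "radius m M = (\<beta> + 1) / 2 * (\<beta> - 1) / (\<beta> - 1)" by (simp only: radius_def h)
    also have "\<dots> = (\<beta> + 1) / 2" by (rule nonzero_mult_div_cancel_right) (use gt1 in simp)
    finally show ?thesis .
  qed
  have cen: "centre m M = \<eta> * ((\<beta> + 1) / 2)"
  proof -
    have "centre m M = \<eta> * radius m M"
      by (simp only: cs mid dual_radius_def h radius_eq times_divide_eq_left times_divide_eq_right mult.left_commute mult.commute)
    then show ?thesis by (simp only: rad)
  qed
  have drad: "dual_radius m M = (1 + 1 / \<beta>) / 2"
    using rad gt1 unfolding radius_eq by (simp add: field_simps)
  have dcen: "dual_centre m M = \<eta> * ((1 - 1 / \<beta>) / 2)"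
  proof -
    have "p / (\<beta> + 1) = (\<beta> - 1) / \<beta>" using gt1 pp by (simp add: frac_eq_eq mult.commute)
    also have "\<dots> = 1 - 1 / \<beta>" using gt1 by (simp add: diff_divide_distrib)
    finally have r: "p / (\<beta> + 1) = 1 - 1 / \<beta>" .
    have "p / 2 / (\<beta> + 1) = p / (\<beta> + 1) / 2" by (simp only: divide_divide_eq_left mult.commute)
    then have "\<eta> * (p / 2) / (\<beta> + 1) = \<eta> * ((1 - 1 / \<beta>) / 2)"
      by (simp only: r flip: times_divide_eq_right)
    then show ?thesis by (simp only: cs mid)
  qed
  have "(\<eta> * x, \<eta> * y) \<in> lattice" using \<eta> xy(1) lattice_uminus by auto
  then obtain a b :: int where ab: "\<eta> * x = a + b * \<beta>" "\<eta> * y = a + b * \<beta>'" by (rule latticeE)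
  have y: "0 < \<eta> * y" "\<eta> * y < \<beta> + 1"
    using xy(2) \<eta> by (auto simp: cen rad abs_less_iff field_simps)
  have x: "- (1 / \<beta>) \<le> \<eta> * x" "\<eta> * x \<le> 1"
  proof -
    have "\<bar>\<eta> * x - (1 - 1 / \<beta>) / 2\<bar> \<le> (1 + 1 / \<beta>) / 2"
    proof -
      have "\<eta> * x - c = \<eta> * (x - \<eta> * c)" for c :: real using \<eta> by auto
      then have "\<bar>\<eta> * x - c\<bar> = \<bar>x - \<eta> * c\<bar>" for c :: real using \<eta> by (auto simp: abs_mult)
      then show ?thesis using xy(3) by (simp only: dcen drad)
    qed
    then show "- (1 / \<beta>) \<le> \<eta> * x" "\<eta> * x \<le> 1" unfolding abs_le_iff by (auto simp: diff_divide_distrib add_divide_distrib)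
  qed
  have conj: "\<beta>' = - (1 / \<beta>)" using conj_eq \<tau> by simp
  define d where "d = \<beta> - \<beta>'"
  have d: "d = \<beta> + 1 / \<beta>" using conj by (simp add: d_def)
  have pos: "0 < 1 / \<beta>" using gt1 by simp
  then have d1: "d > 1" using d gt1 by linarith
  have diff: "\<eta> * x - \<eta> * y = b * d" using ab by (simp add: d_def algebra_simps)
  have range: "- (2 * d) < b * d" "b * d < d"
    unfolding diff[symmetric] using x y pos d d1 by linarith+
  have "real_of_int b < 1"
    using range(2) d1 mult_less_cancel_right_pos[of d "real_of_int b" 1] by simp
  then have b1: "b < 1" by simp
  have "- 2 < real_of_int b"
    using range(1) d1 mult_less_cancel_right_pos[of d "- 2" "real_of_int b"] by simp
  then have b2: "b > - 2" by linarith
  have st: "\<alpha> = - \<beta>" "\<gamma> = - \<beta>'" unfolding \<alpha>_def \<gamma>_def unfolding s by auto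
  have digits: "\<eta> \<in> {m..M}" "\<eta> * p \<in> {m..M}" using mM p by (auto simp: \<eta>_def)
  have "b = 0 \<or> b = - 1" using b1 b2 by linarith
  then show "(x, y) \<in> digit_pairs {m..M}"
  proof
    assume b: "b = 0"
    then have "a = 1" using ab x y by simp
    then have "x = \<eta>" "y = \<eta>" using ab b \<eta> by auto
    then show ?thesis using digit_pairs_digit[OF digits(1)] by simp
  next
    assume b: "b = - 1"
    then have "a - \<beta> \<ge> - (1 / \<beta>)" "a + (1 / \<beta>) < \<beta> + 1" using ab x y conj by auto
    then have "a \<ge> p" "a < p + 1" using pb by linarith+
    then have "a = p" by simp
    then have "x = \<eta> * (p - \<beta>)" "y = \<eta> * (p - \<beta>')" using ab b \<eta> by auto
    then have "x = \<alpha> * of_int \<eta> + of_int (\<eta> * p)" "y = \<gamma> * of_int \<eta> + of_int (\<eta> * p)"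
      by (simp_all add: st algebra_simps)
    then show ?thesis using digit_pairs.step[OF digit_pairs_digit[OF digits(1)] digits(2)] by (simp only:)
  qed
qed

text \<open>
  For the golden ratio the digits \<open>-1, 0, 1\<close> are one more than the least number. The lattice points
  left are \<open>\<plusminus>1\<close>, \<open>\<plusminus>\<beta>\<close>, \<open>\<plusminus>(\<beta> - 1)\<close> and \<open>0\<close>, which have expansions of length at most two.
\<close>

lemma fills_golden:
  assumes "\<tau> = - 1" "\<sigma> = 1" "p = 1"
  shows "fills (- 1) 1"
proof (rule fills_if_residual)
  have conj: "\<beta>' = 1 - \<beta>" using trace assms by simp
  have sq: "\<beta> * \<beta> = \<beta> + 1" using square assms by (simp add: power2_eq_square)
  have b: "\<beta> > 3 / 2" "\<beta> < 2" using beta_gt_three_halves beta_bounds assms by auto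
  show "(- 1 :: int) \<le> 1" "real_of_int (1 - - 1) > \<beta> - 1" using b by auto
  fix x y assume xy: "(x, y) \<in> lattice" "\<bar>y - centre (- 1) 1\<bar> < radius (- 1) 1"
    "\<bar>x - dual_centre (- 1) 1\<bar> \<le> dual_radius (- 1) 1"
  have "1 / (\<beta> - 1) = \<beta>" using sq b by (simp add: field_simps)
  then have dr: "dual_radius (- 1) 1 = \<beta>" by (simp add: dual_radius_def half_width_def)
  have x: "\<bar>x\<bar> \<le> \<beta>" using xy(3) dr by (simp add: dual_centre_def mid_def)
  have y: "\<bar>y\<bar> < \<beta> + 1" using xy(2) sq by (simp add: centre_def mid_def radius_eq dr)
  obtain a b :: int where ab: "x = a + b * \<beta>" "y = a + b * \<beta>'" using xy(1) by (rule latticeE)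
  have "x - y = b * (2 * \<beta> - 1)" using ab by (simp add: conj algebra_simps)
  then have "\<bar>b\<bar> * (2 * \<beta> - 1) = \<bar>x - y\<bar>" using b by (simp add: abs_mult)
  also have "\<dots> < 2 * (2 * \<beta> - 1)" using x y \<open>\<beta> > 3 / 2\<close> by (simp add: abs_le_iff abs_less_iff)
  finally have "real_of_int \<bar>b\<bar> < 2" using \<open>\<beta> > 3 / 2\<close> mult_less_cancel_right_pos[of "2 * \<beta> - 1" "real_of_int \<bar>b\<bar>" 2] by simp
  then have "\<bar>b\<bar> < 2" by linarith
  then have b: "b = 0 \<or> b = 1 \<or> b = - 1" by linarith
  have st: "\<alpha> = \<beta>" "\<gamma> = \<beta>'" unfolding \<alpha>_def \<gamma>_def unfolding assms(2) by auto
  have one: "(1, 1) \<in> digit_pairs {- 1..1}" "(- 1, - 1) \<in> digit_pairs {- 1..1}"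
    using digit_pairs_digit[of 1 "{- 1..1}"] digit_pairs_digit[of "- 1" "{- 1..1}"] by auto
  from b show "(x, y) \<in> digit_pairs {- 1..1}"
  proof (elim disjE)
    assume "b = 0"
    then have "\<bar>real_of_int a\<bar> < 2" using x ab \<open>\<beta> < 2\<close> by simp
    then have "\<bar>a\<bar> < 2" by linarith
    then have "a \<in> {- 1..1}" by auto
    then show ?thesis using digit_pairs_digit ab \<open>b = 0\<close> by simp
  next
    assume "b = 1"
    then have "a + \<beta> \<le> \<beta>" "- (\<beta> + 1) < a + (1 - \<beta>)" using x y ab conj by auto
    then have "a \<in> {- 1..1}" by auto
    from digit_pairs.step[OF one(1) this] show ?thesis using ab \<open>b = 1\<close> by (simp add: st add.commute)
  next
    assume "b = - 1"
    then have "a - \<beta> \<ge> - \<beta>" "a - (1 - \<beta>) < \<beta> + 1" using x y ab conj by auto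
    then have "a \<in> {- 1..1}" by auto
    from digit_pairs.step[OF one(2) this] show ?thesis using ab \<open>b = - 1\<close> by (simp add: st)
  qed
qed

text \<open>
  The case of norm \<open>1\<close> and \<open>p\<close> digits, the least possible number. Here the two points
  \<open>\<plusminus>(1 - 1 / \<beta>)\<close> left by \<open>lattice_small\<close> have to be excluded. For \<open>\<alpha> = \<beta>\<close> their conjugates
  \<open>\<plusminus>(1 - \<beta>)\<close> are not in the open window. For \<open>\<alpha> = -\<beta>\<close> the window is the dual interval scaled by
  \<open>\<beta>\<close>; the two intervals are centred on the same side of \<open>0\<close>, whereas the coordinates of the two
  points have opposite signs.
\<close>

lemma fills_minimal_norm_pos:
  assumes \<tau>: "\<tau> = 1" and adm: "admissible m M" and w: "M - m = p - 1"
  shows "fills m M"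
proof (rule fills_if_residual)
  have p: "p \<ge> 3" using sign \<tau> by simp
  show "m \<le> M" "real_of_int (M - m) > \<beta> - 1" using adm by (auto simp: admissible_def)
  fix x y assume xy: "(x, y) \<in> lattice" "\<bar>y - centre m M\<bar> < radius m M" "\<bar>x - dual_centre m M\<bar> \<le> dual_radius m M"
  have w': "real_of_int p = real_of_int M - real_of_int m + 1" using arg_cong[OF w, of real_of_int] by simp
  have h: "half_width m M = (real_of_int p - 1) / 2" by (simp add: half_width_def w')
  have sq: "(\<beta> - 1) * (\<beta> - 1) = (real_of_int p - 2) * \<beta>"
    using square \<tau> by (simp add: algebra_simps power2_eq_square)
  have scale: "\<beta> * u \<le> \<beta>" if "u < 1" for u using that gt1 by simp
  from \<sigma> show "(x, y) \<in> digit_pairs {m..M}"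
  proof
    assume s: "\<sigma> = 1"
    then have "\<sigma> * \<tau> = 1" using \<tau> by simp
    note cs = dual_centre_signs(1)[OF s] centre_signs(1)[OF this]
    have mid: "\<bar>mid m M\<bar> \<le> (real_of_int p - 1) / 2 - 1"
    proof -
      have "real_of_int m \<le> - 1 \<and> 1 \<le> real_of_int M" using adm s unfolding admissible_def by auto
      then have "\<bar>real_of_int m + real_of_int M\<bar> \<le> real_of_int p - 3" using w' by linarith
      then show ?thesis by (simp add: mid_def field_simps)
    qed
    have "\<bar>mid m M\<bar> / (\<beta> - 1) + dual_radius m M = (\<bar>mid m M\<bar> + (real_of_int p - 1) / 2) / (\<beta> - 1)"
      by (simp only: dual_radius_def h add_divide_distrib)
    also have "\<dots> \<le> (real_of_int p - 2) / (\<beta> - 1)"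
    proof (intro divide_right_mono)
      have "(real_of_int p - 1) / 2 - 1 + (real_of_int p - 1) / 2 = (real_of_int p - 2)" by (simp add: field_simps)
      then show "\<bar>mid m M\<bar> + (real_of_int p - 1) / 2 \<le> real_of_int p - 2"
        using add_right_mono[OF mid, of "(real_of_int p - 1) / 2"] by (simp only:)
    qed (use gt1 in simp)
    also have "\<dots> = (\<beta> - 1) / \<beta>" using sq gt1 by (simp add: frac_eq_eq)
    finally have bound: "\<bar>mid m M / (\<beta> - 1)\<bar> + dual_radius m M \<le> 1 - 1 / \<beta>"
      using gt1 by (simp add: diff_divide_distrib)
    then have less1: "\<bar>mid m M / (\<beta> - 1)\<bar> + dual_radius m M < 1"
    proof -
      have "0 < 1 / \<beta>" using gt1 by simp
      then show ?thesis using bound by linarith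
    qed
    have cr: "\<bar>centre m M\<bar> + radius m M = \<beta> * (\<bar>mid m M / (\<beta> - 1)\<bar> + dual_radius m M)"
      using gt1 by (simp add: cs radius_eq abs_mult distrib_left)
    have "\<dots> \<le> \<beta> * (1 - 1 / \<beta>)" using bound gt1 by (intro mult_left_mono) auto
    also have "\<dots> = \<beta> - 1" using gt1 by (simp add: right_diff_distrib)
    finally have "\<bar>y\<bar> < \<beta> - 1" using xy(2) cr by linarith
    then have "y \<noteq> 1 - \<beta>" "y \<noteq> \<beta> - 1" by auto
    moreover have "\<bar>dual_centre m M\<bar> + dual_radius m M < 1" using less1 by (simp only: cs abs_minus)
    ultimately show ?thesis
      using small_points_in_digit_pairs[OF xy] scale[OF less1] unfolding cr by blast
  next
    assume s: "\<sigma> = - 1"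
    then have "\<sigma> * \<tau> = - 1" using \<tau> by simp
    note cs = dual_centre_signs(2)[OF s] centre_signs(2)[OF this]
    have mid: "\<bar>mid m M\<bar> \<le> (real_of_int p - 1) / 2"
    proof -
      have "real_of_int m \<le> 0 \<and> 0 \<le> real_of_int M" using adm unfolding admissible_def by auto
      then have "\<bar>real_of_int m + real_of_int M\<bar> \<le> real_of_int p - 1" using w' by linarith
      then show ?thesis by (simp add: mid_def field_simps)
    qed
    have "(real_of_int p - 1) / 2 * (\<beta> - 1) + (real_of_int p - 1) / 2 * (\<beta> + 1) < \<beta>\<^sup>2 - 1"
    proof -
      have "(real_of_int p - 1) / 2 * (\<beta> - 1) + (real_of_int p - 1) / 2 * (\<beta> + 1) = (p * \<beta> - \<beta>)"
        by (simp add: field_simps)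
      moreover have "\<beta> > 2" using beta_bounds(2)[OF \<tau>] p by linarith
      ultimately show ?thesis using \<tau> unfolding square by simp
    qed
    then have "((real_of_int p - 1) / 2) / (\<beta> + 1) + ((real_of_int p - 1) / 2) / (\<beta> - 1) < 1" by (rule sum_fractions_less)
    moreover have "\<bar>mid m M\<bar> / (\<beta> + 1) \<le> ((real_of_int p - 1) / 2) / (\<beta> + 1)" using mid gt1 by (intro divide_right_mono) auto
    ultimately have less1: "\<bar>mid m M / (\<beta> + 1)\<bar> + dual_radius m M < 1"
      using gt1 by (simp add: dual_radius_def h)
    define e where "e = mid m M / (\<beta> + 1)"
    define \<rho> where "\<rho> = dual_radius m M"
    have cen: "centre m M = \<beta> * e" "dual_centre m M = e" "radius m M = \<beta> * \<rho>"
      by (auto simp: cs e_def \<rho>_def radius_eq)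
    have \<rho>: "\<rho> \<le> 1 - 1 / \<beta>"
    proof -
      have "(real_of_int p - 1) * \<beta> \<le> 2 * ((real_of_int p - 2) * \<beta>)" using p gt1 by simp
      then have "(real_of_int p - 1) / 2 * \<beta> \<le> (\<beta> - 1) * (\<beta> - 1)" using sq by simp
      moreover have "q / (\<beta> - 1) \<le> (\<beta> - 1) / \<beta>" if "q * \<beta> \<le> (\<beta> - 1) * (\<beta> - 1)" for q
        using that gt1 by (simp add: divide_le_eq le_divide_eq mult.commute)
      ultimately have "dual_radius m M \<le> (\<beta> - 1) / \<beta>" by (simp only: dual_radius_def h)
      then show ?thesis using gt1 by (simp add: \<rho>_def diff_divide_distrib)
    qed
    have yy: "\<bar>y / \<beta> - e\<bar> < \<rho>"
    proof -
      have "y - \<beta> * e = \<beta> * (y / \<beta> - e)" using gt1 by (simp add: right_diff_distrib)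
      then have "\<beta> * \<bar>y / \<beta> - e\<bar> < \<beta> * \<rho>" using xy(2) gt1 by (simp add: cen abs_mult)
      then show ?thesis using gt1 by simp
    qed
    have xx: "\<bar>x - e\<bar> \<le> \<rho>" using xy(3) cen \<rho>_def by simp
    (* An interval of radius rho does not contain two opposite numbers of absolute value at least rho,
       the second one in its interior. *)
    have no: "\<not> (x = u \<and> y / \<beta> = - u)" if "\<rho> \<le> \<bar>u\<bar>" for u
    proof
      assume "x = u \<and> y / \<beta> = - u"
      then have "\<bar>u - e\<bar> \<le> \<rho>" "\<bar>- u - e\<bar> < \<rho>" using xx yy by auto
      then show False using that by linarith
    qed
    have pos: "1 - 1 / \<beta> > 0" using gt1 by simp
    have "(1 - \<beta>) / \<beta> = - (1 - 1 / \<beta>)" "(\<beta> - 1) / \<beta> = - (1 / \<beta> - 1)"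
      using gt1 by (auto simp: diff_divide_distrib)
    then have "\<not> (x = 1 - 1 / \<beta> \<and> y = 1 - \<beta>)" "\<not> (x = 1 / \<beta> - 1 \<and> y = \<beta> - 1)"
      using no[of "1 - 1 / \<beta>"] no[of "1 / \<beta> - 1"] \<rho> pos by auto
    moreover have "\<bar>centre m M\<bar> + radius m M = \<beta> * (\<bar>e\<bar> + \<rho>)"
      using gt1 by (simp add: cen abs_mult distrib_left)
    moreover have "\<bar>dual_centre m M\<bar> + dual_radius m M < 1" "\<beta> * (\<bar>e\<bar> + \<rho>) \<le> \<beta>"
      using less1 scale[OF less1] by (simp_all only: cs e_def \<rho>_def)
    ultimately show ?thesis
      using small_points_in_digit_pairs[OF xy] by simp
  qed
qed

text \<open>
  Digits are removed, keeping \<open>0\<close> and for \<open>\<alpha> = \<beta>\<close> also \<open>\<plusminus>1\<close>, until the number of digits is the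
  least integer above \<open>\<beta>\<close>, or three for the positive golden ratio.
\<close>

lemma fills_if_admissible: "admissible m M \<Longrightarrow> fills m M"
proof (induction "nat (M - m)" arbitrary: m M rule: less_induct)
  case less
  note adm = less.prems
  show ?case
  proof (cases "real_of_int (M - m) > \<beta> \<and> (\<sigma> = 1 \<longrightarrow> M - m > 2)")
    case True
    have "M - m \<ge> 2" using True gt1 by linarith
    define c :: int where "c = (if \<sigma> = 1 then 1 else 0)"
    have c: "M > c \<or> m < - c" using True \<open>M - m \<ge> 2\<close> by (auto simp: c_def)
    then obtain m1 M1 where le: "m \<le> m1" "m1 \<le> M1" "M1 \<le> M" and one: "M1 - m1 = M - m - 1"
      and mM1: "m1 \<le> - c" "c \<le> M1"
    proof
      assume "M > c"
      then show ?thesis using that[of m "M - 1"] adm by (auto simp: c_def admissible_def split: if_splits)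
    next
      assume "m < - c"
      then show ?thesis using that[of "m + 1" M] adm by (auto simp: c_def admissible_def split: if_splits)
    qed
    have "admissible m1 M1" using mM1 True one unfolding admissible_def c_def by (auto split: if_splits)
    moreover have "nat (M1 - m1) < nat (M - m)" using one \<open>M - m \<ge> 2\<close> by simp
    ultimately have "fills m1 M1" using less.hyps by blast
    then show ?thesis using fills_enlarge le one True by blast
  next
    case False
    then have small: "real_of_int (M - m) \<le> \<beta> \<or> \<sigma> = 1 \<and> M - m \<le> 2" by auto
    from sign show ?thesis
    proof
      assume t: "\<tau> = - 1 \<and> p \<ge> 1"
      note b = beta_bounds(1)[OF conjunct1[OF t]]
      (* The integers p and p - 1 are the integer parts of beta for norm -1 and 1 respectively. *)
      have lower: "M - m \<ge> p" using adm b by (auto simp: admissible_def)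
      show ?thesis
      proof (cases "\<sigma> = 1 \<and> p = 1")
        case True
        have "M - m \<le> 2"
          using small b True by linarith
        then have "m = - 1" "M = 1" using adm True unfolding admissible_def by auto
        then show ?thesis using fills_golden True t by simp
      next
        case notgold: False
        have w: "M - m = p"
        proof (rule ccontr)
          assume "M - m \<noteq> p"
          then have "M - m \<ge> p + 1" using lower by simp
          then have "real_of_int (M - m) > \<beta>" using b by linarith
          then show False using small notgold t \<open>M - m \<ge> p + 1\<close> by auto
        qed
        show ?thesis
        proof (cases "m < 0 \<and> 0 < M")
          case True
          then show ?thesis using fills_minimal_norm_neg_inner t w by blast
        next
          case False
          then have "m = 0 \<and> M = p \<or> m = - p \<and> M = 0" "\<sigma> = - 1"
            using adm w \<sigma> unfolding admissible_def by auto
          then show ?thesis using fills_minimal_norm_neg_extreme t by blast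
        qed
      qed
    next
      assume t: "\<tau> = 1 \<and> p \<ge> 3"
      note b = beta_bounds(2)[OF conjunct1[OF t]]
      have "M - m \<le> p - 1" using small b t by linarith
      moreover have "M - m \<ge> p - 1" using adm b unfolding admissible_def by linarith
      ultimately show ?thesis using fills_minimal_norm_pos adm t by simp
    qed
  qed
qed


section \<open>The spectrum as a cut-and-project set\<close>

text \<open>
  The map \<open>y \<mapsto> \<gamma>y + a\<close> sends the window into itself, so all conjugates stay in the open window if
  the starting point \<open>0\<close> lies there.
\<close>

lemma digit_pairs_in_window:
  assumes "\<bar>centre m M\<bar> < radius m M" "(x, y) \<in> digit_pairs {m..M}"
  shows "\<bar>y - centre m M\<bar> < radius m M"
  using assms(2)
proof induction
  case zero
  show ?case using assms(1) by simp
next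
  case (step x y a)
  have "real_of_int m \<le> a" "a \<le> real_of_int M" using step.hyps by auto
  then have a: "\<bar>a - mid m M\<bar> \<le> half_width m M"
    by (auto simp: mid_def half_width_def abs_le_iff add_divide_distrib diff_divide_distrib)
  have "\<gamma> * y + a - centre m M = \<gamma> * (y - centre m M) + (a - mid m M)"
    using centre_fixed[of m M] by (simp add: algebra_simps)
  also have "\<bar>\<dots>\<bar> \<le> \<bar>\<gamma> * (y - centre m M)\<bar> + \<bar>a - mid m M\<bar>" by (rule abs_triangle_ineq)
  also have "\<dots> < radius m M / \<beta> + half_width m M"
  proof (rule add_less_le_mono[OF _ a])
    show "\<bar>\<gamma> * (y - centre m M)\<bar> < radius m M / \<beta>"
      using step.IH gt1 by (simp add: abs_mult abs_gamma divide_strict_right_mono)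
  qed
  also have "\<dots> = radius m M" by (rule radius_fixed)
  finally show ?case .
qed

lemma radius_positive: "m < M \<Longrightarrow> radius m M > 0"
  using gt1 by (simp add: radius_def half_width_def)

text \<open>
  The point \<open>0\<close> can be an end of the window only if \<open>\<gamma> > 0\<close>, so that the ends are
  \<open>m / (1 - \<gamma>)\<close> and \<open>M / (1 - \<gamma>)\<close>, and \<open>0\<close> is an extreme digit.
\<close>

lemma zero_in_open_window:
  assumes "m < M" and "m \<le> 0" "0 \<le> M" and "m < 0 \<and> 0 < M \<or> \<sigma> * \<tau> = - 1"
  shows "\<bar>centre m M\<bar> < radius m M"
proof -
  have b: "0 < \<beta>" "0 < \<beta> - 1" "0 < \<beta> + 1" using gt1 by auto
  have "real_of_int m \<le> 0" "0 \<le> real_of_int M" "real_of_int m < M" using assms by auto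
  then have le: "\<bar>mid m M\<bar> \<le> half_width m M" and h: "half_width m M > 0"
    by (auto simp: mid_def half_width_def abs_le_iff field_simps)
  consider "\<sigma> * \<tau> = - 1" | "\<sigma> * \<tau> = 1" "m < 0" "0 < M"
    using assms(4) \<sigma> sign by force
  then have "\<bar>centre m M\<bar> < \<beta> * (half_width m M / (\<beta> - 1))"
  proof cases
    case 1
    have "\<bar>centre m M\<bar> = \<beta> * (\<bar>mid m M\<bar> / (\<beta> + 1))"
      using b by (simp add: centre_signs(2)[OF 1] abs_mult)
    also have "\<dots> \<le> \<beta> * (half_width m M / (\<beta> + 1))"
      using b le by (intro mult_left_mono divide_right_mono) auto
    also have "\<dots> < \<beta> * (half_width m M / (\<beta> - 1))"
      using b h by (intro mult_strict_left_mono divide_strict_left_mono mult_pos_pos) auto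
    finally show ?thesis .
  next
    case 2
    have "real_of_int m < 0" "0 < real_of_int M" using 2 by auto
    then have "\<bar>mid m M\<bar> < half_width m M"
      by (auto simp: mid_def half_width_def abs_less_iff field_simps)
    moreover have "\<bar>centre m M\<bar> = \<beta> * (\<bar>mid m M\<bar> / (\<beta> - 1))"
      using b by (simp add: centre_signs(1)[OF 2(1)] abs_mult)
    ultimately show ?thesis
      using b by (simp add: divide_strict_right_mono)
  qed
  then show ?thesis by (simp add: radius_def mult.commute)
qed

lemma digit_spectrum_open_window:
  assumes adm: "admissible m M" and zero: "\<bar>centre m M\<bar> < radius m M"
  shows "digit_spectrum {m..M} \<alpha> = {x. \<exists>y. (x, y) \<in> lattice \<and> \<bar>y - centre m M\<bar> < radius m M}"
proof -
  have "0 \<in> {m..M}" using adm by (simp add: admissible_def)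
  then have "digit_spectrum {m..M} \<alpha> = {x. \<exists>y. (x, y) \<in> digit_pairs {m..M}}"
    by (rule digit_spectrum_eq)
  also have "\<dots> = {x. \<exists>y. (x, y) \<in> lattice \<and> \<bar>y - centre m M\<bar> < radius m M}"
    using fills_if_admissible[OF adm] digit_pairs_in_window[OF zero] digit_pairs_lattice unfolding fills_def by blast
  finally show ?thesis .
qed

text \<open>
  If \<open>0\<close> is an end of the window, then it belongs to the spectrum while the other end is not
  attained. The sign \<open>\<eta>\<close> reflects the window to \<open>[0, 2 \<cdot> radius)\<close>. Apart from \<open>0\<close> the lattice has
  no point with conjugate \<open>0\<close>, so that everything else reduces to the open window.
\<close>

lemma digit_spectrum_half_open_window:
  assumes adm: "admissible m M" and st: "\<sigma> * \<tau> = 1" and \<eta>: "\<eta> = 1 \<and> m = 0 \<or> \<eta> = - 1 \<and> M = 0"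
    and "m < M"
  shows "digit_spectrum {m..M} \<alpha> = {x. \<exists>y. (x, y) \<in> lattice \<and> 0 \<le> \<eta> * y \<and> \<eta> * y < 2 * radius m M}"
proof -
  have \<gamma>: "\<gamma> = 1 / \<beta>" unfolding gamma_eq of_int_mult[symmetric] st by simp
  have "mid m M = \<eta> * half_width m M" using \<eta> by (auto simp: mid_def half_width_def)
  then have cen: "centre m M = \<eta> * radius m M"
    unfolding centre_signs(1)[OF st] by (simp add: radius_def)
  have \<eta>1: "\<eta> * \<eta> = 1" using \<eta> by auto
  have half_open: "0 \<le> \<eta> * y \<and> \<eta> * y < 2 * radius m M" if "(x, y) \<in> digit_pairs {m..M}" for x y
    using that
  proof induction
    case zero
    show ?case using radius_positive[OF \<open>m < M\<close>] by simp
  next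
    case (step x y a)
    have a: "0 \<le> \<eta> * a" "\<eta> * a \<le> M - m" using step.hyps \<eta> by auto
    have "\<eta> * (\<gamma> * y + a) = \<eta> * y / \<beta> + \<eta> * a" by (simp add: \<gamma> distrib_left)
    moreover have "0 \<le> \<eta> * y / \<beta>" "\<eta> * y / \<beta> < 2 * radius m M / \<beta>"
      using step.IH gt1 by (auto simp: divide_strict_right_mono)
    moreover have "2 * radius m M / \<beta> + (M - m) = 2 * radius m M"
      using radius_fixed[of m M] by (simp add: half_width_def field_simps)
    ultimately show ?case using a by linarith
  qed
  have window: "\<bar>y - centre m M\<bar> < radius m M \<longleftrightarrow> 0 < \<eta> * y \<and> \<eta> * y < 2 * radius m M" for y
    unfolding cen using \<eta> by auto
  have iff: "(x, y) \<in> digit_pairs {m..M} \<longleftrightarrow> (x, y) \<in> lattice \<and> 0 \<le> \<eta> * y \<and> \<eta> * y < 2 * radius m M" for x y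
  proof
    assume "(x, y) \<in> digit_pairs {m..M}"
    then show "(x, y) \<in> lattice \<and> 0 \<le> \<eta> * y \<and> \<eta> * y < 2 * radius m M"
      using digit_pairs_lattice half_open by blast
  next
    assume xy: "(x, y) \<in> lattice \<and> 0 \<le> \<eta> * y \<and> \<eta> * y < 2 * radius m M"
    show "(x, y) \<in> digit_pairs {m..M}"
    proof (cases "y = 0")
      case True
      then show ?thesis using xy lattice_snd_zero digit_pairs.zero by auto
    next
      case False
      then have "\<bar>y - centre m M\<bar> < radius m M" using xy \<eta> unfolding window by auto
      then show ?thesis using xy fills_if_admissible[OF adm] by (simp add: fills_def)
    qed
  qed
  have "0 \<in> {m..M}" using adm by (simp add: admissible_def)
  then show ?thesis by (simp only: digit_spectrum_eq iff)
qed

lemma digit_spectrum_cut_and_project: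
  assumes adm: "admissible m M" and "m < M"
  obtains \<kappa> t W where "\<kappa> \<noteq> 0" "W = {0..<1} \<or> W = {0<..<1}"
    "digit_spectrum {m..M} \<alpha> = {x. \<exists>y. (x, y) \<in> (\<lambda>(x, y). (x, \<kappa> * y)) ` lattice \<and> y + t \<in> W}"
proof -
  define r where "r = 2 * radius m M"
  have r: "r > 0" using radius_positive[OF \<open>m < M\<close>] by (simp add: r_def)
  have scaled: "{x. \<exists>y. (x, y) \<in> (\<lambda>(x, y). (x, \<kappa> * y)) ` lattice \<and> y + t \<in> W} =
      {x. \<exists>y. (x, y) \<in> lattice \<and> \<kappa> * y + t \<in> W}" for \<kappa> t :: real and W
    by force
  have m0: "m \<le> 0" "0 \<le> M" using adm by (auto simp: admissible_def)
  show ?thesis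
  proof (cases "m < 0 \<and> 0 < M \<or> \<sigma> * \<tau> = - 1")
    case True
    note zero = zero_in_open_window[OF \<open>m < M\<close> m0 True]
    have iff: "1 / r * y + (1 / 2 - centre m M / r) \<in> {0<..<1} \<longleftrightarrow> \<bar>y - centre m M\<bar> < radius m M" for y
    proof -
      have "1 / r * y + (1 / 2 - centre m M / r) = (y - centre m M + radius m M) / r"
        using r by (simp add: r_def field_simps)
      also have "\<dots> \<in> {0<..<1} \<longleftrightarrow> \<bar>y - centre m M\<bar> < radius m M"
        using r by (auto simp: r_def zero_less_divide_iff)
      finally show ?thesis .
    qed
    show ?thesis
      by (rule that[of "1 / r" "{0<..<1}" "1 / 2 - centre m M / r"])
        (use r in \<open>simp_all only: scaled iff digit_spectrum_open_window[OF adm zero]\<close>, simp_all)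
  next
    case False
    then have st: "\<sigma> * \<tau> = 1" using \<sigma> sign by auto
    define \<eta> :: real where "\<eta> = (if m = 0 then 1 else - 1)"
    have \<eta>: "\<eta> = 1 \<and> m = 0 \<or> \<eta> = - 1 \<and> M = 0" using False m0 by (auto simp: \<eta>_def)
    have iff: "\<eta> / r * y + 0 \<in> {0..<1} \<longleftrightarrow> 0 \<le> \<eta> * y \<and> \<eta> * y < 2 * radius m M" for y
      using r by (auto simp: r_def zero_le_divide_iff)
    show ?thesis
      by (rule that[of "\<eta> / r" "{0..<1}" 0])
        (use r \<eta> in \<open>simp_all only: scaled iff digit_spectrum_half_open_window[OF adm st \<eta> \<open>m < M\<close>]\<close>, auto)
  qed
qed

end

lemma quadratic_pisot_unit_conjugate:
  assumes "quadratic_pisot_unit \<beta>"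
  obtains \<beta>' p \<tau> where "quadratic_unit \<beta> \<beta>' p \<tau>"
proof -
  have gt1: "\<beta> > 1" using assms by (simp add: quadratic_pisot_unit_def)
  obtain p \<tau> :: int where s: "\<tau> = - 1 \<and> p \<ge> 1 \<or> \<tau> = 1 \<and> p \<ge> 3" and root: "\<beta>\<^sup>2 - p * \<beta> + \<tau> = 0"
    using assms by (force simp: quadratic_pisot_unit_def larger_root_def)
  have "quadratic_unit \<beta> (p - \<beta>) p \<tau>"
    using gt1 s root by unfold_locales (auto simp: algebra_simps power2_eq_square)
  then show ?thesis by (rule that)
qed

theorem theorem2:
  fixes \<beta> \<alpha> :: real and D :: "int set"
  assumes "quadratic_pisot_unit \<beta>"
    and "\<exists>m M. D = {m..M}" and "0 \<in> D" and "real (card D) > \<beta>"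
    and "\<alpha> = - \<beta> \<or> (\<alpha> = \<beta> \<and> {-1, 0, 1} \<subseteq> D)"
  shows "\<exists>\<Delta>\<^sub>1 \<Delta>\<^sub>2. \<Delta>\<^sub>1 > 0 \<and> \<Delta>\<^sub>2 > 0 \<and>
    (\<forall>x z. consecutive_in (digit_spectrum D \<alpha>) x z \<longrightarrow> z - x \<in> {\<Delta>\<^sub>1, \<Delta>\<^sub>2, \<Delta>\<^sub>1 + \<Delta>\<^sub>2}) \<and>
    (\<exists>y. increasing_enumeration (digit_spectrum D \<alpha>) y) \<and>
    (\<exists>a c. (a, c) \<in> {(\<Delta>\<^sub>1, \<Delta>\<^sub>2), (\<Delta>\<^sub>2, \<Delta>\<^sub>1)} \<and>
      (\<forall>y. increasing_enumeration (digit_spectrum D \<alpha>) y \<longrightarrow>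
        (\<exists>u. (\<forall>k. y (k + 1) - y k = gap_value a c (u k)) \<and>
             (iet3_word u \<or> open_iet3_word u))))"
proof -
  obtain \<beta>' p \<tau> where "quadratic_unit \<beta> \<beta>' p \<tau>"
    using quadratic_pisot_unit_conjugate assms(1) by blast
  then interpret quadratic_unit \<beta> \<beta>' p \<tau> .
  define \<sigma> :: int where "\<sigma> = (if \<alpha> = \<beta> then 1 else - 1)"
  interpret S: signed_quadratic_unit \<beta> \<beta>' p \<tau> \<sigma>
    by unfold_locales (simp add: \<sigma>_def)
  have \<alpha>: "S.\<alpha> = \<alpha>" using assms(5) unfolding S.\<alpha>_def unfolding \<sigma>_def by auto
  obtain m M where D: "D = {m..M}" using assms(2) by blast
  have mM: "m \<le> 0" "0 \<le> M" using assms(3) D by auto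
  then have "real (card D) = M - m + 1" by (simp add: D)
  then have wide: "real_of_int (M - m) > \<beta> - 1" using assms(4) by simp
  then have "m < M" using gt1 by linarith
  have adm: "S.admissible m M"
    using mM wide assms(5) gt1 unfolding S.admissible_def unfolding \<sigma>_def D by (auto split: if_splits)
  obtain \<kappa> t W where \<kappa>: "\<kappa> \<noteq> 0" and W: "W = {0..<1} \<or> W = {0<..<1}"
    and X: "digit_spectrum {m..M} S.\<alpha> = {x. \<exists>y. (x, y) \<in> (\<lambda>(x, y). (x, \<kappa> * y)) ` lattice \<and> y + t \<in> W}"
    by (rule S.digit_spectrum_cut_and_project[OF adm \<open>m < M\<close>]) blast
  note X = X[unfolded \<alpha>, folded D]
  have "0 \<in> digit_spectrum D \<alpha>"
    using S.digit_spectrum_eq[OF assms(3)] S.digit_pairs.zero[of D] unfolding \<alpha> by blast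
  then have "digit_spectrum D \<alpha> \<noteq> {}" by blast
  from planar_lattice.cut_and_project_coding[OF planar_lattice_scaled[OF \<kappa>] X this W]
  show ?thesis by blast
qed

end
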